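(* Let $\phi,\psi$ be a compactly supported orthonormal MRA scaling function and wavelet with $\mathrm{supp}(\phi)=\mathrm{supp}(\psi)=[0,a]$, $a\ge 1$, and let the reconstruction spaces $\mathcal{T}_N$, the sampling spaces $\mathcal{S}_M=\mathcal{S}^\epsilon_M$ (with sampling density $0<\epsilon\le 1/(T_1+T_2)$), the integers $N_R$, the quantities $C_{N,M}$ and the stable sampling rate $\Theta(N;\theta)$ be as defined in the context. Then for all $\theta\in(1,\infty)$ there exists $S_\theta\in\mathbb{N}$, independent of $R$, such that for every $R\in\mathbb{N}$ and every $N\le N_R$, with $$M=\left\lceil \frac{S_\theta 2^{R+1}}{\epsilon}\right\rceil,$$ one has $C_{N,M}\ge \frac{1}{\theta}$. In particular, $$\Theta(N;\theta)\le \left\lceil \frac{2S_\theta N}{\epsilon\lceil a\rceil}\right\rceil .$$ Hence $\Theta(N;\theta)=\mathcal{O}(N)$ as $N\to\infty$ for any $\theta\in(1,\infty)$.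
   Context: $\mathbb{N}=\{1,2,\dots\}$, $\mathbb{Z}_+=\{0,1,2,\dots\}$. Work in $\mathcal{H}=L^2(\mathbb{R})$ with its usual inner product $\langle\cdot,\cdot\rangle$ and norm $\|\cdot\|$. Wavelets: $\phi$ is a scaling function generating a multiresolution analysis (MRA): closed subspaces $V_j\subset V_{j+1}$ ($j\in\mathbb{Z}$) of $L^2(\mathbb{R})$ with $f\in V_j\iff f(2\cdot)\in V_{j+1}$, $\bigcap_j V_j=\{0\}$, $\overline{\bigcup_j V_j}=L^2(\mathbb{R})$, and $\{\phi(\cdot-k):k\in\mathbb{Z}\}$ an orthonormal basis of $V_0$; $\psi$ is an associated wavelet (so $\{\psi(\cdot-k):k\in\mathbb{Z}\}$ is an orthonormal basis of the orthogonal complement of $V_0$ in $V_1$). It is assumed that $\mathrm{supp}(\phi)=\mathrm{supp}(\psi)=[0,a]$ with $a\ge 1$. Write $\phi_{j,k}=2^{j/2}\phi(2^j\cdot-k)$, $\psi_{j,k}=2^{j/2}\psi(2^j\cdot-k)$. Reconstruction space: $\Omega_a=\{\phi_{0,k}: |k|\le\lceil a\rceil-1\}\cup\{\psi_{j,k}: j\in\mathbb{Z}_+,\,-\lceil a\rceil+1\le k\le 2^j\lceil a\rceil-1\}$, enumerated as $\{\varphi_j\}_{j\in\mathbb{N}}$ by listing first the $\phi_{0,k}$ in increasing order of $k$, then the $\psi_{0,k}$ in increasing order of $k$, then the $\psi_{1,k}$ in increasing order of $k$, and so on. $\mathcal{T}=\overline{\mathrm{span}}\,\Omega_a$, $\mathcal{T}_N=\mathrm{span}\{\varphi_1,\dots,\varphi_N\}$.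 For $R\in\mathbb{N}$, $N_R=2^R\lceil a\rceil+(R+1)(\lceil a\rceil-1)$. Sampling space: $T_1\ge\lceil a\rceil-1$ and $T_2\ge 2\lceil a\rceil-1$ are fixed, so that $\mathcal{T}\subset L^2[-T_1,T_2]$. For $0<\epsilon\le 1/(T_1+T_2)$ and $l\in\mathbb{Z}$, $$s_l^\epsilon=\sqrt{\epsilon}\,e^{2\pi i l\epsilon\,\cdot}\,\chi_{[-T_1/(\epsilon(T_1+T_2)),\,T_2/(\epsilon(T_1+T_2))]},$$ $\mathcal{S}_M^\epsilon=\mathrm{span}\{s_l^\epsilon: -\lfloor M/2\rfloor\le l\le\lceil M/2\rceil-1\}$, and $P_M=P_M^\epsilon$ is the orthogonal projection of $\mathcal{H}$ onto $\mathcal{S}_M^\epsilon$. Define $C_{N,M}=\inf\{\|P_M\varphi\|:\varphi\in\mathcal{T}_N,\|\varphi\|=1\}$ and, for $\theta\in(1,\infty)$, $\Theta(N;\theta)=\min\{M\in\mathbb{N}: 1/C_{N,M}<\theta\}$ (with $1/0=\infty$). *)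

theory Defs
  imports "HOL-Analysis.Analysis" "HOL-Library.Landau_Symbols" "HOL-Library.Extended_Nat"
    "HOL-Library.Function_Algebras"
begin

text \<open>
  Elements of \<open>L\<^sup>2(\<real>)\<close> are handled through representatives: complex-valued, Lebesgue measurable,
  square-integrable functions. All notions below respect equality almost everywhere; in particular
  closures are taken for the seminorm \<open>L2_norm\<close>, so a closed subspace contains with \<open>f\<close> every
  function that equals \<open>f\<close> almost everywhere.
\<close>

definition L2 :: "(real \<Rightarrow> complex) set" where
  "L2 = {f \<in> borel_measurable lebesgue. integrable lebesgue (\<lambda>x. (cmod (f x))\<^sup>2)}"

definition L2_inner :: "(real \<Rightarrow> complex) \<Rightarrow> (real \<Rightarrow> complex) \<Rightarrow> complex" where
  "L2_inner f g = (LINT x|lebesgue. f x * cnj (g x))"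

definition L2_norm :: "(real \<Rightarrow> complex) \<Rightarrow> real" where
  "L2_norm f = sqrt (LINT x|lebesgue. (cmod (f x))\<^sup>2)"

definition L2_closure :: "(real \<Rightarrow> complex) set \<Rightarrow> (real \<Rightarrow> complex) set" where
  "L2_closure S = {f \<in> L2. \<forall>e>0. \<exists>g\<in>S. L2_norm (\<lambda>x. f x - g x) < e}"

definition fscale :: "complex \<Rightarrow> (real \<Rightarrow> complex) \<Rightarrow> real \<Rightarrow> complex" where
  "fscale c f = (\<lambda>x. c * f x)"

global_interpretation cfun: vector_space fscale
  defines cfun_span = cfun.span and cfun_subspace = cfun.subspace
  by unfold_locales (auto simp: fscale_def fun_eq_iff algebra_simps)

definition L2_closed_subspace :: "(real \<Rightarrow> complex) set \<Rightarrow> bool" where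
  "L2_closed_subspace V \<longleftrightarrow> V \<subseteq> L2 \<and> cfun_subspace V \<and> L2_closure V = V"

definition L2_onb :: "(int \<Rightarrow> real \<Rightarrow> complex) \<Rightarrow> (real \<Rightarrow> complex) set \<Rightarrow> bool" where
  "L2_onb e V \<longleftrightarrow>
     range e \<subseteq> V \<and>
     (\<forall>k l. L2_inner (e k) (e l) = (if k = l then 1 else 0)) \<and>
     L2_closure (cfun_span (range e)) = V"

text \<open>
  The orthogonal projection onto a subspace \<open>S\<close> of \<open>L\<^sup>2\<close>. The residual condition determines
  the value up to a null set.
\<close>

definition L2_proj :: "(real \<Rightarrow> complex) set \<Rightarrow> (real \<Rightarrow> complex) \<Rightarrow> real \<Rightarrow> complex" where
  "L2_proj S f = (SOME p. p \<in> S \<and> (\<forall>s\<in>S. L2_inner (\<lambda>x. f x - p x) s = 0))"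

text \<open>The support of an \<open>L\<^sup>2\<close> class: complement of the largest open set on which it vanishes a.e.\<close>

definition ess_supp :: "(real \<Rightarrow> complex) \<Rightarrow> real set" where
  "ess_supp f = - \<Union>{U. open U \<and> (AE x in lebesgue. x \<in> U \<longrightarrow> f x = 0)}"

definition mra :: "(int \<Rightarrow> (real \<Rightarrow> complex) set) \<Rightarrow> (real \<Rightarrow> complex) \<Rightarrow> bool" where
  "mra V \<phi> \<longleftrightarrow>
     (\<forall>j. L2_closed_subspace (V j)) \<and>
     (\<forall>j. V j \<subseteq> V (j + 1)) \<and>
     (\<forall>j f. f \<in> V j \<longleftrightarrow> (\<lambda>x. f (2 * x)) \<in> V (j + 1)) \<and>
     (\<Inter>j. V j) = {f \<in> L2. AE x in lebesgue. f x = 0} \<and>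
     L2_closure (\<Union>j. V j) = L2 \<and>
     L2_onb (\<lambda>k x. \<phi> (x - of_int k)) (V 0)"

definition assoc_wavelet :: "(int \<Rightarrow> (real \<Rightarrow> complex) set) \<Rightarrow> (real \<Rightarrow> complex) \<Rightarrow> bool" where
  "assoc_wavelet V \<psi> \<longleftrightarrow>
     L2_onb (\<lambda>k x. \<psi> (x - of_int k)) {f \<in> V 1. \<forall>g\<in>V 0. L2_inner f g = 0}"

definition dilate :: "(real \<Rightarrow> complex) \<Rightarrow> nat \<Rightarrow> int \<Rightarrow> real \<Rightarrow> complex" where
  "dilate f j k = (\<lambda>x. of_real (2 powr (real j / 2)) * f (2 ^ j * x - of_int k))"

definition Omega :: "(real \<Rightarrow> complex) \<Rightarrow> (real \<Rightarrow> complex) \<Rightarrow> real \<Rightarrow> (real \<Rightarrow> complex) set" where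
  "Omega \<phi> \<psi> a =
     {dilate \<phi> 0 k |k. \<bar>k\<bar> \<le> \<lceil>a\<rceil> - 1} \<union>
     {dilate \<psi> j k |j k. - \<lceil>a\<rceil> + 1 \<le> k \<and> k \<le> 2 ^ j * \<lceil>a\<rceil> - 1}"

text \<open>
  The first elements of the reconstruction system in their prescribed order: all \<open>\<phi>\<close>-terms, followed by the
  \<open>\<psi>\<close>-terms of scales \<open>j < R\<close>. These lists extend each other and the \<open>n\<close>-th one has more than \<open>n\<close>
  entries, so the entry at position \<open>n - 1\<close> of the \<open>n\<close>-th list is the \<open>n\<close>-th element
  of the enumeration (which starts at \<open>n = 1\<close>).
\<close>

definition Omega_list ::
  "(real \<Rightarrow> complex) \<Rightarrow> (real \<Rightarrow> complex) \<Rightarrow> real \<Rightarrow> nat \<Rightarrow> (real \<Rightarrow> complex) list" where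
  "Omega_list \<phi> \<psi> a R =
     map (dilate \<phi> 0) [- (\<lceil>a\<rceil> - 1)..\<lceil>a\<rceil> - 1] @
     concat (map (\<lambda>j. map (dilate \<psi> j) [- \<lceil>a\<rceil> + 1..2 ^ j * \<lceil>a\<rceil> - 1]) [0..<R])"

definition Omega_enum ::
  "(real \<Rightarrow> complex) \<Rightarrow> (real \<Rightarrow> complex) \<Rightarrow> real \<Rightarrow> nat \<Rightarrow> real \<Rightarrow> complex" where
  "Omega_enum \<phi> \<psi> a n = Omega_list \<phi> \<psi> a n ! (n - 1)"

definition recon_space ::
  "(real \<Rightarrow> complex) \<Rightarrow> (real \<Rightarrow> complex) \<Rightarrow> real \<Rightarrow> nat \<Rightarrow> (real \<Rightarrow> complex) set" where
  "recon_space \<phi> \<psi> a N = cfun_span (Omega_enum \<phi> \<psi> a ` {1..N})"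

definition recon_dim :: "real \<Rightarrow> nat \<Rightarrow> nat" where
  "recon_dim a R = 2 ^ R * nat \<lceil>a\<rceil> + (R + 1) * (nat \<lceil>a\<rceil> - 1)"

definition sampling_fun :: "real \<Rightarrow> real \<Rightarrow> real \<Rightarrow> int \<Rightarrow> real \<Rightarrow> complex" where
  "sampling_fun T1 T2 \<epsilon> l = (\<lambda>x.
     of_real (sqrt \<epsilon>) * exp (2 * of_real pi * \<i> * of_int l * of_real \<epsilon> * of_real x) *
     indicator {- T1 / (\<epsilon> * (T1 + T2))..T2 / (\<epsilon> * (T1 + T2))} x)"

definition sampling_space :: "real \<Rightarrow> real \<Rightarrow> real \<Rightarrow> nat \<Rightarrow> (real \<Rightarrow> complex) set" where
  "sampling_space T1 T2 \<epsilon> M =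
     cfun_span (sampling_fun T1 T2 \<epsilon> ` {- \<lfloor>real M / 2\<rfloor>..\<lceil>real M / 2\<rceil> - 1})"

definition subspace_cos ::
  "(real \<Rightarrow> complex) \<Rightarrow> (real \<Rightarrow> complex) \<Rightarrow> real \<Rightarrow> real \<Rightarrow> real \<Rightarrow> real \<Rightarrow> nat \<Rightarrow> nat \<Rightarrow> real" where
  "subspace_cos \<phi> \<psi> a T1 T2 \<epsilon> N M =
     Inf {L2_norm (L2_proj (sampling_space T1 T2 \<epsilon> M) f) |f.
            f \<in> recon_space \<phi> \<psi> a N \<and> L2_norm f = 1}"

text \<open>
  The stable sampling rate; it is \<open>\<infinity>\<close> if no \<open>M\<close> qualifies, and otherwise the infimum is a minimum.
  The quotient is formed in \<open>ereal\<close>, where \<open>1 / 0 = \<infinity>\<close>.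
\<close>

definition stable_sampling_rate ::
  "(real \<Rightarrow> complex) \<Rightarrow> (real \<Rightarrow> complex) \<Rightarrow> real \<Rightarrow> real \<Rightarrow> real \<Rightarrow> real \<Rightarrow> nat \<Rightarrow> real \<Rightarrow> enat" where
  "stable_sampling_rate \<phi> \<psi> a T1 T2 \<epsilon> N \<theta> =
     Inf (enat ` {M. 1 \<le> M \<and> 1 / ereal (subspace_cos \<phi> \<psi> a T1 T2 \<epsilon> N M) < ereal \<theta>})"

lemma length_Omega_list:
  assumes "1 \<le> a"
  shows "length (Omega_list \<phi> \<psi> a R) = recon_dim a R"
proof -
  obtain c where c: "\<lceil>a\<rceil> = int (Suc c)"
  proof -
    have "1 \<le> \<lceil>a\<rceil>" using assms by linarith
    then show ?thesis using that[of "nat (\<lceil>a\<rceil> - 1)"] by simp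
  qed
  have c': "nat \<lceil>a\<rceil> = Suc c" by (simp only: c nat_int)
  have 1: "length [- \<lceil>a\<rceil> + 1..2 ^ j * \<lceil>a\<rceil> - 1] = 2 ^ j * Suc c + c" for j
  proof -
    have "2 ^ j * \<lceil>a\<rceil> - 1 - (- \<lceil>a\<rceil> + 1) + 1 = int (2 ^ j * Suc c + c)"
      by (simp add: c algebra_simps)
    then show ?thesis by (metis length_upto nat_int)
  qed
  have 2: "length [- (\<lceil>a\<rceil> - 1)..\<lceil>a\<rceil> - 1] = Suc c + c" by (simp add: c)
  show ?thesis
    unfolding Omega_list_def
  proof (induction R)
    case 0 show ?case using 2 by (simp add: recon_dim_def c' del: length_upto)
  next
    case (Suc R)
    then show ?case using 1[of R] 2 by (simp add: recon_dim_def c' algebra_simps del: length_upto)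
  qed
qed

lemma Omega_enum_eq:
  assumes "1 \<le> a" "1 \<le> n" "n \<le> recon_dim a R"
  shows "Omega_enum \<phi> \<psi> a n = Omega_list \<phi> \<psi> a R ! (n - 1)"
proof -
  have ext: "\<exists>ys. Omega_list \<phi> \<psi> a S = Omega_list \<phi> \<psi> a R @ ys" if "R \<le> S" for R S
    using that
  proof (induction S rule: dec_induct)
    case (step S) then show ?case by (auto simp: Omega_list_def)
  qed simp
  have "1 \<le> nat \<lceil>a\<rceil>" using assms by linarith
  then have "2 ^ n * 1 \<le> 2 ^ n * nat \<lceil>a\<rceil>" by (intro mult_le_mono) auto
  then have n: "n \<le> recon_dim a n"
    unfolding recon_dim_def using less_exp[of n] by linarith
  show ?thesis
  proof (cases "R \<le> n")
    case True
    with ext[of R n] assms n show ?thesis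
      by (auto simp: Omega_enum_def nth_append length_Omega_list)
  next
    case False
    with ext[of n R] assms n show ?thesis
      by (auto simp: Omega_enum_def nth_append length_Omega_list)
  qed
qed

lemma Omega_enum_image:
  assumes "1 \<le> a"
  shows "Omega_enum \<phi> \<psi> a ` {1..} = Omega \<phi> \<psi> a"
proof
  have sub: "set (Omega_list \<phi> \<psi> a R) \<subseteq> Omega \<phi> \<psi> a" for R
    by (force simp: Omega_list_def Omega_def)
  have "n \<le> recon_dim a n" for n
  proof -
    have "1 \<le> nat \<lceil>a\<rceil>" using assms by linarith
    then have "2 ^ n * 1 \<le> 2 ^ n * nat \<lceil>a\<rceil>" by (intro mult_le_mono) auto
    then show ?thesis unfolding recon_dim_def using less_exp[of n] by linarith
  qed
  then have "Omega_enum \<phi> \<psi> a n \<in> set (Omega_list \<phi> \<psi> a n)" if "1 \<le> n" for n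
    unfolding Omega_enum_def using that assms
    by (intro nth_mem) (metis One_nat_def diff_less length_Omega_list less_le_trans zero_less_one)
  with sub show "Omega_enum \<phi> \<psi> a ` {1..} \<subseteq> Omega \<phi> \<psi> a" by fastforce
  have "f \<in> Omega_enum \<phi> \<psi> a ` {1..}" if f: "f \<in> set (Omega_list \<phi> \<psi> a R)" for f R
  proof -
    obtain i where i: "i < recon_dim a R" "f = Omega_list \<phi> \<psi> a R ! i"
      using f assms by (metis in_set_conv_nth length_Omega_list)
    then have "f = Omega_enum \<phi> \<psi> a (Suc i)"
      using Omega_enum_eq[of a "Suc i" R] assms by simp
    then show ?thesis by auto
  qed
  moreover have "\<exists>R. f \<in> set (Omega_list \<phi> \<psi> a R)" if "f \<in> Omega \<phi> \<psi> a" for f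
  proof -
    from that consider k where "f = dilate \<phi> 0 k" "\<bar>k\<bar> \<le> \<lceil>a\<rceil> - 1"
      | j k where "f = dilate \<psi> j k" "- \<lceil>a\<rceil> + 1 \<le> k" "k \<le> 2 ^ j * \<lceil>a\<rceil> - 1"
      unfolding Omega_def by blast
    then show ?thesis
    proof cases
      case 1 then have "f \<in> set (Omega_list \<phi> \<psi> a 0)"
        by (auto simp: Omega_list_def intro!: imageI)
      then show ?thesis ..
    next
      case 2 then have "f \<in> set (Omega_list \<phi> \<psi> a (Suc j))" by (auto simp: Omega_list_def)
      then show ?thesis ..
    qed
  qed
  ultimately show "Omega \<phi> \<psi> a \<subseteq> Omega_enum \<phi> \<psi> a ` {1..}" by blast
qed

end

theory Submission
  imports Defs
begin

text \<open>
  For \<open>N \<le> N\<^sub>R\<close> an element of the reconstruction space lies in \<open>V\<^sub>R\<close> and is supported in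
  \<open>[-T\<^sub>1, T\<^sub>2]\<close>, hence it is a finite superposition of functions \<open>\<phi>(2\<^sup>R x - k)\<close> that are
  themselves supported there. Replacing \<open>\<phi>\<close> by a smooth \<open>g\<close> costs an error that is uniform in \<open>R\<close>,
  as only boundedly many translates overlap. The superposition of the \<open>g(2\<^sup>R x - k)\<close> has a derivative
  of norm \<open>O(2\<^sup>R)\<close>, so by integration by parts and Bessel's inequality its Fourier coefficients
  beyond \<open>M\<close> have total energy \<open>O((2\<^sup>R / (\<epsilon> M))\<^sup>2)\<close>. No Fourier transform is needed; completeness
  of the exponentials enters through the Stone-Weierstrass theorem.
\<close>

subsection \<open>Square-integrable functions\<close>

text \<open>A lower bound for the cosine is a distance bound: for a unit vector f and any t in the
  sampling space, ||P f||^2 >= 1 - ||f - t||^2. So one t per f with ||f - t||^2 <= 1 - c^2 is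
  enough; c is taken strictly between 1/\<theta> and 1 because \<Theta> asks for a strict
  inequality. The obstacle is that the constant must not depend on R. With b = 2^R, a unit f has
  coefficients of total energy b against the unnormalised \<phi>(b x - k), and each of these
  translates has squared norm 1/b. The two factors cancel, so replacing \<phi> by one fixed g costs
  the same at every scale. Each single translate must lie in the sampling interval, not only their
  sum: a cancellation between translates of \<phi> would not survive the passage to g. With each of
  them inside and g vanishing at 0 and a, no boundary terms arise, and the superposition is
  continuous with equal values at both ends. One integration by parts suffices, so g' carries no end
  conditions.\<close>

lemma L2_integrable_norm: "f \<in> L2 \<Longrightarrow> integrable lebesgue (\<lambda>x. (cmod (f x))\<^sup>2)"
  by (simp add: L2_def)

lemma norm_add_square_le: "(norm (x + y))\<^sup>2 \<le> 2 * (norm x)\<^sup>2 + 2 * (norm y)\<^sup>2"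
  for x y :: "'a::real_normed_vector"
proof -
  have "(norm (x + y))\<^sup>2 \<le> (norm x + norm y)\<^sup>2"
    by (intro power_mono norm_triangle_ineq) auto
  also have "\<dots> \<le> 2 * (norm x)\<^sup>2 + 2 * (norm y)\<^sup>2"
    using sum_squares_bound[of "norm x" "norm y"] by (simp add: power2_sum)
  finally show ?thesis .
qed

lemma L2_scale: "f \<in> L2 \<Longrightarrow> (\<lambda>x. c * f x) \<in> L2"
  by (auto simp: L2_def norm_mult power_mult_distrib)

lemma L2_add:
  assumes "f \<in> L2" "g \<in> L2"
  shows "(\<lambda>x. f x + g x) \<in> L2"
proof -
  have [measurable]: "f \<in> borel_measurable lebesgue" "g \<in> borel_measurable lebesgue"
    using assms by (auto simp: L2_def)
  have "integrable lebesgue (\<lambda>x. (cmod (f x + g x))\<^sup>2)"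
  proof (rule Bochner_Integration.integrable_bound)
    show "integrable lebesgue (\<lambda>x. 2 * (cmod (f x))\<^sup>2 + 2 * (cmod (g x))\<^sup>2)"
      using assms by (auto simp: L2_def)
  qed (auto intro!: AE_I2 norm_add_square_le)
  then show ?thesis by (simp add: L2_def)
qed

lemma L2_diff: "f \<in> L2 \<Longrightarrow> g \<in> L2 \<Longrightarrow> (\<lambda>x. f x - g x) \<in> L2"
  using L2_add[of f "\<lambda>x. - 1 * g x"] L2_scale[of g "- 1"] by simp

lemma L2_zero: "(\<lambda>x. 0) \<in> L2"
  by (simp add: L2_def)

lemma L2_sum: "(\<And>i. i \<in> A \<Longrightarrow> f i \<in> L2) \<Longrightarrow> (\<lambda>x. \<Sum>i\<in>A. f i x) \<in> L2"
  by (induction A rule: infinite_finite_induct) (auto intro: L2_add L2_zero)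

lemma L2_integrable_mult:
  assumes "f \<in> L2" "g \<in> L2"
  shows "integrable lebesgue (\<lambda>x. f x * cnj (g x))"
proof (rule Bochner_Integration.integrable_bound)
  have [measurable]: "f \<in> borel_measurable lebesgue" "g \<in> borel_measurable lebesgue"
    using assms by (auto simp: L2_def)
  have [measurable]: "(\<lambda>x. cnj (g x)) \<in> borel_measurable lebesgue"
    by (rule measurable_compose[OF _ borel_measurable_continuous_onI]) (auto intro: continuous_intros)
  show "integrable lebesgue (\<lambda>x. (cmod (f x))\<^sup>2 + (cmod (g x))\<^sup>2)"
    using assms by (auto simp: L2_def)
  show "(\<lambda>x. f x * cnj (g x)) \<in> borel_measurable lebesgue" by measurable
  have "norm (f x * cnj (g x)) \<le> norm ((cmod (f x))\<^sup>2 + (cmod (g x))\<^sup>2)" for x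
  proof -
    have "0 \<le> cmod (f x) * cmod (g x)" by simp
    then have "cmod (f x) * cmod (g x) \<le> (cmod (f x))\<^sup>2 + (cmod (g x))\<^sup>2"
      using sum_squares_bound[of "cmod (f x)" "cmod (g x)"] by linarith
    then show ?thesis by (simp add: norm_mult)
  qed
  then show "AE x in lebesgue. norm (f x * cnj (g x)) \<le> norm ((cmod (f x))\<^sup>2 + (cmod (g x))\<^sup>2)"
    by auto
qed

lemma L2_norm_nonneg: "0 \<le> L2_norm f"
  by (simp add: L2_norm_def)

lemma L2_norm_square: "(L2_norm f)\<^sup>2 = (LINT x|lebesgue. (cmod (f x))\<^sup>2)"
  by (simp add: L2_norm_def)

lemma L2_norm_cong_AE:
  assumes "f \<in> L2" "g \<in> L2" "AE x in lebesgue. f x = g x"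
  shows "L2_norm f = L2_norm g"
proof -
  have "(LINT x|lebesgue. (cmod (f x))\<^sup>2) = (LINT x|lebesgue. (cmod (g x))\<^sup>2)"
    using assms by (intro integral_cong_AE borel_measurable_integrable L2_integrable_norm) auto
  then show ?thesis by (simp add: L2_norm_def)
qed

lemma L2_inner_self: "L2_inner f f = of_real ((L2_norm f)\<^sup>2)"
  by (simp only: L2_inner_def L2_norm_square complex_norm_square[symmetric] integral_complex_of_real)

lemma L2_inner_commute: "L2_inner g f = cnj (L2_inner f g)"
  proof -
  have "cnj (LINT x|lebesgue. f x * cnj (g x)) = (LINT x|lebesgue. cnj (f x * cnj (g x)))"
    by (rule Bochner_Integration.integral_cnj[symmetric])
  then show ?thesis by (simp add: L2_inner_def mult.commute)
qed

lemma L2_inner_add_left: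
  "\<lbrakk>f \<in> L2; g \<in> L2; h \<in> L2\<rbrakk> \<Longrightarrow> L2_inner (\<lambda>x. f x + g x) h = L2_inner f h + L2_inner g h"
  unfolding L2_inner_def
  by (simp add: distrib_right Bochner_Integration.integral_add L2_integrable_mult)

lemma L2_inner_scale_left: "L2_inner (\<lambda>x. c * f x) g = c * L2_inner f g"
  unfolding L2_inner_def by (simp add: mult.assoc)

lemma L2_inner_diff_left:
  "\<lbrakk>f \<in> L2; g \<in> L2; h \<in> L2\<rbrakk> \<Longrightarrow> L2_inner (\<lambda>x. f x - g x) h = L2_inner f h - L2_inner g h"
  unfolding L2_inner_def
  by (simp add: left_diff_distrib Bochner_Integration.integral_diff L2_integrable_mult)

lemma L2_inner_sum_left:
  assumes "\<And>i. i \<in> A \<Longrightarrow> f i \<in> L2" "h \<in> L2"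
  shows "L2_inner (\<lambda>x. \<Sum>i\<in>A. f i x) h = (\<Sum>i\<in>A. L2_inner (f i) h)"
  unfolding L2_inner_def sum_distrib_right
  using assms by (intro Bochner_Integration.integral_sum L2_integrable_mult) auto

lemma L2_inner_scale_right: "L2_inner f (\<lambda>x. c * g x) = cnj c * L2_inner f g"
  by (subst (1 2) L2_inner_commute) (simp add: L2_inner_scale_left)

lemma L2_inner_sum_right:
  assumes "\<And>i. i \<in> A \<Longrightarrow> f i \<in> L2" "h \<in> L2"
  shows "L2_inner h (\<lambda>x. \<Sum>i\<in>A. f i x) = (\<Sum>i\<in>A. L2_inner h (f i))"
  by (subst (1 2) L2_inner_commute) (use assms in \<open>simp add: L2_inner_sum_left\<close>)

text \<open>A substitute for the triangle inequality that follows pointwise, without Cauchy-Schwarz.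
  The factors 2 are absorbed by the error budgets below.\<close>

lemma L2_norm_add_le:
  assumes "f \<in> L2" "g \<in> L2"
  shows "(L2_norm (\<lambda>x. f x + g x))\<^sup>2 \<le> 2 * (L2_norm f)\<^sup>2 + 2 * (L2_norm g)\<^sup>2"
proof -
  have "(L2_norm (\<lambda>x. f x + g x))\<^sup>2 \<le> (LINT x|lebesgue. 2 * (cmod (f x))\<^sup>2 + 2 * (cmod (g x))\<^sup>2)"
    unfolding L2_norm_square
    using assms L2_add[OF assms] norm_add_square_le
    by (intro integral_mono) (auto simp: L2_integrable_norm)
  also have "\<dots> = 2 * (L2_norm f)\<^sup>2 + 2 * (L2_norm g)\<^sup>2"
    unfolding L2_norm_square using assms
    by (simp add: L2_integrable_norm)
  finally show ?thesis .
qed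

lemma L2_pythagoras:
  assumes "f \<in> L2" "g \<in> L2" "L2_inner f g = 0"
  shows "(L2_norm (\<lambda>x. f x + g x))\<^sup>2 = (L2_norm f)\<^sup>2 + (L2_norm g)\<^sup>2"
proof -
  have "L2_inner g f = 0" using assms(3) L2_inner_commute[of g f] by simp
  have "L2_inner (\<lambda>x. f x + g x) (\<lambda>x. f x + g x) = L2_inner f f + L2_inner g g"
  proof -
    have 1: "L2_inner h (\<lambda>x. f x + g x) = L2_inner h f + L2_inner h g" if "h \<in> L2" for h
      by (subst (1 2 3) L2_inner_commute) (use assms that in \<open>simp add: L2_inner_add_left\<close>)
    show ?thesis
      using assms \<open>L2_inner g f = 0\<close> by (simp add: L2_inner_add_left L2_add 1)
  qed
  then have "complex_of_real ((L2_norm (\<lambda>x. f x + g x))\<^sup>2) = of_real ((L2_norm f)\<^sup>2 + (L2_norm g)\<^sup>2)"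
    by (simp add: L2_inner_self)
  then show ?thesis using of_real_eq_iff by blast
qed

lemma L2_pythagoras_diff:
  assumes "f \<in> L2" "g \<in> L2" "L2_inner f g = 0"
  shows "(L2_norm (\<lambda>x. f x - g x))\<^sup>2 = (L2_norm f)\<^sup>2 + (L2_norm g)\<^sup>2"
proof -
  have "(L2_norm (\<lambda>x. f x + - 1 * g x))\<^sup>2 = (L2_norm f)\<^sup>2 + (L2_norm (\<lambda>x. - 1 * g x))\<^sup>2"
    using assms L2_inner_scale_right[of f "- 1" g] L2_scale[of g "- 1"]
    by (intro L2_pythagoras) simp_all
  then show ?thesis by (simp add: L2_norm_def)
qed

lemma L2_dominated:
  assumes "g \<in> L2" "f \<in> borel_measurable lebesgue" "\<And>x. cmod (f x) \<le> cmod (g x)"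
  shows "f \<in> L2"
proof -
  have "integrable lebesgue (\<lambda>x. (cmod (f x))\<^sup>2)"
    using L2_integrable_norm[OF assms(1)]
    by (rule Bochner_Integration.integrable_bound) (use assms in \<open>auto simp: power_mono\<close>)
  then show ?thesis using assms by (simp add: L2_def)
qed

lemma L2_restrict:
  assumes "f \<in> L2"
  shows "(\<lambda>x. f x * indicator {p..q::real} x) \<in> L2"
  using assms by (intro L2_dominated[OF assms] borel_measurable_times borel_measurable_indicator)
    (auto simp: L2_def indicator_def)

lemma L2_inner_linear_combination_left:
  assumes "\<And>i. i \<in> A \<Longrightarrow> f i \<in> L2" "h \<in> L2"
  shows "L2_inner (\<lambda>x. \<Sum>i\<in>A. c i * f i x) h = (\<Sum>i\<in>A. c i * L2_inner (f i) h)"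
  using assms by (subst L2_inner_sum_left) (auto intro: L2_scale simp: L2_inner_scale_left)

lemma L2_norm_eq_0_imp_AE:
  assumes "f \<in> L2" "L2_norm f = 0"
  shows "AE x in lebesgue. f x = 0"
proof -
  have "(LINT x|lebesgue. (cmod (f x))\<^sup>2) = 0"
    using assms(2) L2_norm_square[of f] by simp
  then have "AE x in lebesgue. (cmod (f x))\<^sup>2 = 0"
    using L2_integrable_norm[OF assms(1)] by (subst (asm) integral_nonneg_eq_0_iff_AE) auto
  then show ?thesis by simp
qed

subsection \<open>Finite orthonormal families\<close>

text \<open>Serves two families: the sampling functions and the integer translates of \<phi>. Only
  finite index sets are used for expansions, so no question of convergence arises.\<close>

locale L2_orthonormal =
  fixes e :: "'i \<Rightarrow> real \<Rightarrow> complex"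
  assumes L2: "\<And>i. e i \<in> L2"
    and orthonormal: "\<And>i j. L2_inner (e i) (e j) = (if i = j then 1 else 0)"
begin

definition part :: "'i set \<Rightarrow> (real \<Rightarrow> complex) \<Rightarrow> real \<Rightarrow> complex" where
  "part A f = (\<lambda>x. \<Sum>i\<in>A. L2_inner f (e i) * e i x)"

lemma sum_L2: "(\<lambda>x. \<Sum>i\<in>A. c i * e i x) \<in> L2"
  by (intro L2_sum L2_scale L2)

lemma part_L2: "part A f \<in> L2"
  unfolding part_def by (rule sum_L2)

lemma inner_sum_left:
  assumes "finite A"
  shows "L2_inner (\<lambda>x. \<Sum>i\<in>A. c i * e i x) (e j) = (if j \<in> A then c j else 0)"
proof -
  have "L2_inner (\<lambda>x. \<Sum>i\<in>A. c i * e i x) (e j) = (\<Sum>i\<in>A. c i * L2_inner (e i) (e j))"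
    by (subst L2_inner_sum_left) (auto simp: L2 L2_scale L2_inner_scale_left)
  also have "\<dots> = (if j \<in> A then c j else 0)"
    using assms by (simp add: orthonormal if_distrib if_distribR cong: if_cong)
  finally show ?thesis .
qed

lemma norm_sum:
  assumes "finite A"
  shows "(L2_norm (\<lambda>x. \<Sum>i\<in>A. c i * e i x))\<^sup>2 = (\<Sum>i\<in>A. (cmod (c i))\<^sup>2)"
proof -
  let ?s = "\<lambda>x. \<Sum>i\<in>A. c i * e i x"
  have "L2_inner ?s ?s = (\<Sum>i\<in>A. cnj (c i) * L2_inner ?s (e i))"
    by (subst L2_inner_sum_right) (auto simp: L2 L2_scale sum_L2 L2_inner_scale_right)
  also have "\<dots> = (\<Sum>i\<in>A. cnj (c i) * c i)"
    using assms by (simp add: inner_sum_left)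
  also have "\<dots> = of_real (\<Sum>i\<in>A. (cmod (c i))\<^sup>2)"
    by (simp only: complex_norm_square of_real_sum mult.commute)
  finally show ?thesis unfolding L2_inner_self using of_real_eq_iff by blast
qed

lemma inner_residual:
  assumes "finite A" "f \<in> L2" "j \<in> A"
  shows "L2_inner (\<lambda>x. f x - part A f x) (e j) = 0"
proof -
  have "L2_inner (part A f) (e j) = L2_inner f (e j)"
    unfolding part_def using assms by (subst inner_sum_left) auto
  then show ?thesis
    using assms by (subst L2_inner_diff_left) (auto simp: part_L2 L2)
qed

lemma span_form:
  assumes "s \<in> cfun_span (e ` A)" "finite A"
  obtains c where "s = (\<lambda>x. \<Sum>i\<in>A. c i * e i x)"
proof -
  \<comment> \<open>Equal vectors with different indices would have inner product both 1 and 0.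
    Injectivity turns the sum over the image into a sum over indices.\<close>
  have inj: "inj_on e A"
    by (rule inj_onI) (metis orthonormal zero_neq_one)
  from assms obtain u where "s = (\<Sum>v\<in>e ` A. fscale (u v) v)"
    using cfun.span_finite[of "e ` A"] by auto
  then have "s = (\<Sum>i\<in>A. fscale (u (e i)) (e i))"
    using inj by (simp add: sum.reindex)
  then have "s = (\<lambda>x. \<Sum>i\<in>A. u (e i) * e i x)"
    by (induction A arbitrary: s rule: infinite_finite_induct) (auto simp: fscale_def fun_eq_iff)
  then show thesis by (rule that)
qed

lemma sum_in_span: "(\<lambda>x. \<Sum>i\<in>A. c i * e i x) \<in> cfun_span (e ` A)"
proof -
  have "(\<lambda>x. \<Sum>i\<in>A. c i * e i x) = (\<Sum>i\<in>A. fscale (c i) (e i))"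
    by (induction A rule: infinite_finite_induct) (auto simp: fscale_def fun_eq_iff)
  also have "\<dots> \<in> cfun_span (e ` A)"
    by (intro cfun.span_sum cfun.span_scale cfun.span_base) auto
  finally show ?thesis .
qed

lemma span_L2:
  assumes "s \<in> cfun_span (e ` A)" "finite A"
  shows "s \<in> L2"
  using assms by (rule span_form) (simp add: sum_L2)

lemma inner_residual_span:
  assumes "finite A" "f \<in> L2" "s \<in> cfun_span (e ` A)"
  shows "L2_inner (\<lambda>x. f x - part A f x) s = 0"
proof -
  obtain c where s: "s = (\<lambda>x. \<Sum>i\<in>A. c i * e i x)" using assms span_form by blast
  show ?thesis
    unfolding s by (subst L2_inner_sum_right)
      (auto simp: L2 L2_scale L2_diff part_L2 assms L2_inner_scale_right inner_residual)
qed

text \<open>\<open>L2_proj\<close> is a choice, so its defining condition must first be shown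
  satisfiable; the expansion \<open>part A f\<close> is the witness. Later estimates use the
  condition only.\<close>

lemma projection:
  assumes "finite A" "f \<in> L2"
  defines "p \<equiv> L2_proj (cfun_span (e ` A)) f"
  shows "p \<in> cfun_span (e ` A)"
    and "s \<in> cfun_span (e ` A) \<Longrightarrow> L2_inner (\<lambda>x. f x - p x) s = 0"
proof -
  have "part A f \<in> cfun_span (e ` A)" unfolding part_def by (rule sum_in_span)
  with assms inner_residual_span
  have "part A f \<in> cfun_span (e ` A) \<and>
      (\<forall>s\<in>cfun_span (e ` A). L2_inner (\<lambda>x. f x - part A f x) s = 0)" by blast
  then have "p \<in> cfun_span (e ` A) \<and> (\<forall>s\<in>cfun_span (e ` A). L2_inner (\<lambda>x. f x - p x) s = 0)"
    unfolding p_def L2_proj_def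
    by (rule someI[where P = "\<lambda>p. p \<in> _ \<and> (\<forall>s\<in>_. L2_inner (\<lambda>x. f x - p x) s = 0)"])
  then show "p \<in> cfun_span (e ` A)"
    and "s \<in> cfun_span (e ` A) \<Longrightarrow> L2_inner (\<lambda>x. f x - p x) s = 0" by auto
qed

text \<open>Pythagoras for f - s = (f - p) - (s - p). Stated for any p with orthogonal residual, so
  that it covers both \<open>L2_proj\<close> and \<open>part\<close>.\<close>

lemma best_approximation:
  assumes "finite A" "f \<in> L2" "p \<in> cfun_span (e ` A)"
    and orth: "\<And>s. s \<in> cfun_span (e ` A) \<Longrightarrow> L2_inner (\<lambda>x. f x - p x) s = 0"
    and "s \<in> cfun_span (e ` A)"
  shows "(L2_norm (\<lambda>x. f x - p x))\<^sup>2 \<le> (L2_norm (\<lambda>x. f x - s x))\<^sup>2"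
proof -
  have ps: "(\<lambda>x. s x - p x) \<in> cfun_span (e ` A)"
    using cfun.span_diff[OF assms(5,3)] by (simp add: fun_diff_def)
  have "(L2_norm (\<lambda>x. (f x - p x) - (s x - p x)))\<^sup>2 = (L2_norm (\<lambda>x. f x - p x))\<^sup>2 + (L2_norm (\<lambda>x. s x - p x))\<^sup>2"
    using assms ps span_L2 by (intro L2_pythagoras_diff L2_diff orth) auto
  then show ?thesis by simp
qed

text \<open>The bridge from approximation to the cosine: any single candidate s in the span bounds
  the norm of the projection from below.\<close>

lemma norm_projection:
  assumes "finite A" "f \<in> L2" "s \<in> cfun_span (e ` A)"
  shows "(L2_norm (L2_proj (cfun_span (e ` A)) f))\<^sup>2 \<ge> (L2_norm f)\<^sup>2 - (L2_norm (\<lambda>x. f x - s x))\<^sup>2"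
proof -
  let ?p = "L2_proj (cfun_span (e ` A)) f"
  note p = projection[OF assms(1,2)]
  have "(L2_norm (\<lambda>x. (f x - ?p x) + ?p x))\<^sup>2 = (L2_norm (\<lambda>x. f x - ?p x))\<^sup>2 + (L2_norm ?p)\<^sup>2"
    using assms p span_L2 by (intro L2_pythagoras L2_diff) auto
  moreover have "(L2_norm (\<lambda>x. f x - ?p x))\<^sup>2 \<le> (L2_norm (\<lambda>x. f x - s x))\<^sup>2"
    using assms p by (intro best_approximation) auto
  ultimately show ?thesis by simp
qed

text \<open>Measures a Fourier tail with finite sets only: for large B the first term can be made
  small by density, the second is estimated coefficientwise. The case A = {} yields Bessel's
  inequality.\<close>

lemma residual_antimono:
  assumes "finite B" "A \<subseteq> B" "f \<in> L2"
  shows "(L2_norm (\<lambda>x. f x - part A f x))\<^sup>2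
    = (L2_norm (\<lambda>x. f x - part B f x))\<^sup>2 + (\<Sum>i\<in>B - A. (cmod (L2_inner f (e i)))\<^sup>2)"
proof -
  have split: "part B f x = part A f x + part (B - A) f x" for x
    unfolding part_def using assms(1,2) by (metis (lifting) sum.subset_diff add.commute)
  have "part (B - A) f \<in> cfun_span (e ` (B - A))" unfolding part_def by (rule sum_in_span)
  then have "part (B - A) f \<in> cfun_span (e ` B)"
    by (rule set_rev_mp) (auto intro!: cfun.span_mono)
  then have "L2_inner (\<lambda>x. f x - part B f x) (part (B - A) f) = 0"
    using assms by (intro inner_residual_span) auto
  then have "(L2_norm (\<lambda>x. (f x - part B f x) + part (B - A) f x))\<^sup>2
      = (L2_norm (\<lambda>x. f x - part B f x))\<^sup>2 + (L2_norm (part (B - A) f))\<^sup>2"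
    using assms by (intro L2_pythagoras L2_diff part_L2)
  moreover have "(L2_norm (part (B - A) f))\<^sup>2 = (\<Sum>i\<in>B - A. (cmod (L2_inner f (e i)))\<^sup>2)"
    unfolding part_def using assms by (intro norm_sum) auto
  ultimately show ?thesis by (simp add: split)
qed

lemma bessel:
  assumes "finite A" "f \<in> L2"
  shows "(\<Sum>i\<in>A. (cmod (L2_inner f (e i)))\<^sup>2) \<le> (L2_norm f)\<^sup>2"
proof -
  have "(L2_norm (\<lambda>x. f x - part {} f x))\<^sup>2
    = (L2_norm (\<lambda>x. f x - part A f x))\<^sup>2 + (\<Sum>i\<in>A - {}. (cmod (L2_inner f (e i)))\<^sup>2)"
    using assms by (intro residual_antimono) auto
  then show ?thesis by (simp add: part_def)
qed

end

subsection \<open>Affine changes of variable\<close>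

lemma nn_integral_L2_norm:
  assumes "f \<in> L2"
  shows "(\<integral>\<^sup>+x. ennreal ((cmod (f x))\<^sup>2) \<partial>lebesgue) = ennreal ((L2_norm f)\<^sup>2)"
  unfolding L2_norm_square by (intro nn_integral_eq_integral L2_integrable_norm assms) simp

lemma L2_affine:
  fixes c t :: real
  assumes f: "f \<in> L2" and c: "c \<noteq> 0"
  shows "(\<lambda>x. f (t + c * x)) \<in> L2"
    and "\<bar>c\<bar> * (L2_norm (\<lambda>x. f (t + c * x)))\<^sup>2 = (L2_norm f)\<^sup>2"
proof -
  have T[measurable]: "(\<lambda>x. t + c * x) \<in> lebesgue \<rightarrow>\<^sub>M lebesgue"
    using lebesgue_affine_measurable[where c = "\<lambda>x::real. c" and t = t] c by simp
  have m[measurable]: "f \<in> borel_measurable lebesgue" using f by (simp add: L2_def)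
  have m': "(\<lambda>x. f (t + c * x)) \<in> borel_measurable lebesgue" by measurable
  \<comment> \<open>The substitution is made in the nonnegative integral, which presupposes no
    integrability; its finiteness then gives membership in \<open>L2\<close>.\<close>
  have eq: "ennreal ((L2_norm f)\<^sup>2) = ennreal \<bar>c\<bar> * (\<integral>\<^sup>+x. ennreal ((cmod (f (t + c * x)))\<^sup>2) \<partial>lebesgue)"
    unfolding nn_integral_L2_norm[OF f, symmetric]
    using c by (intro nn_integral_real_affine_lebesgue) auto
  have "(\<integral>\<^sup>+x. ennreal ((cmod (f (t + c * x)))\<^sup>2) \<partial>lebesgue) < \<infinity>"
  proof (rule ccontr)
    assume "\<not> ?thesis"
    then have "(\<integral>\<^sup>+x. ennreal ((cmod (f (t + c * x)))\<^sup>2) \<partial>lebesgue) = \<infinity>"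
      using top.not_eq_extremum by fastforce
    with eq c show False by (simp add: ennreal_mult_top)
  qed
  then have "integrable lebesgue (\<lambda>x. (cmod (f (t + c * x)))\<^sup>2)"
    using m' by (intro integrableI_bounded) auto
  then show g: "(\<lambda>x. f (t + c * x)) \<in> L2" using m' by (simp add: L2_def)
  show "\<bar>c\<bar> * (L2_norm (\<lambda>x. f (t + c * x)))\<^sup>2 = (L2_norm f)\<^sup>2"
    using eq unfolding nn_integral_L2_norm[OF g] by (simp flip: ennreal_mult')
qed

text \<open>An affine bijection pulls null sets back to null sets: substitution applied to the
  indicator of the exceptional set.\<close>

lemma AE_affine:
  fixes c t :: real
  assumes "AE x in lebesgue. P x" "c \<noteq> 0"
  shows "AE x in lebesgue. P (t + c * x)"
proof -
  obtain N where N: "N \<in> null_sets lebesgue" "{x. \<not> P x} \<subseteq> N"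
    using assms(1) by (auto simp: eventually_ae_filter)
  have [measurable]: "N \<in> sets lebesgue" using N by auto
  have T[measurable]: "(\<lambda>x. t + c * x) \<in> lebesgue \<rightarrow>\<^sub>M lebesgue"
    using lebesgue_affine_measurable[where c = "\<lambda>x::real. c" and t = t] assms(2) by simp
  have "(\<integral>\<^sup>+x. indicator N x \<partial>lebesgue) = ennreal \<bar>c\<bar> * (\<integral>\<^sup>+x. indicator N (t + c * x) \<partial>lebesgue)"
    using assms(2) by (intro nn_integral_real_affine_lebesgue) auto
  then have "(\<integral>\<^sup>+x. indicator N (t + c * x) \<partial>lebesgue) = (0::ennreal)"
    using N assms(2) by (simp add: null_setsD1)
  then have "AE x in lebesgue. indicator N (t + c * x) = (0::ennreal)"
    by (subst (asm) nn_integral_0_iff_AE) auto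
  then show ?thesis
    by eventually_elim (use N in \<open>auto simp: indicator_def split: if_splits\<close>)
qed

subsection \<open>Integrals of continuous functions over intervals\<close>

lemma has_bochner_integral_lebesgue_FTC:
  fixes F f :: "real \<Rightarrow> complex"
  assumes "p \<le> q"
    and "\<And>x. p \<le> x \<Longrightarrow> x \<le> q \<Longrightarrow> (F has_vector_derivative f x) (at x within {p..q})"
    and "continuous_on {p..q} f"
  shows "has_bochner_integral lebesgue (\<lambda>x. f x * indicator {p..q} x) (F q - F p)"
proof -
  have "has_bochner_integral lborel (\<lambda>x. indicator {p..q} x *\<^sub>R f x) (F q - F p)"
    using assms by (rule has_bochner_integral_FTC_Icc)
  moreover have "(\<lambda>x. indicator {p..q} x *\<^sub>R f x) = (\<lambda>x. f x * indicator {p..q} x)"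
    by (auto simp: indicator_def)
  ultimately have *: "has_bochner_integral lborel (\<lambda>x. f x * indicator {p..q} x) (F q - F p)"
    by simp
  then have "(\<lambda>x. f x * indicator {p..q} x) \<in> borel_measurable lborel"
    by (auto simp: has_bochner_integral_iff)
  with * show ?thesis
    by (simp add: has_bochner_integral_iff integrable_completion integral_completion)
qed

lemma L2_continuous_on:
  fixes f :: "real \<Rightarrow> complex"
  assumes "continuous_on {p..q} f"
  shows "(\<lambda>x. f x * indicator {p..q} x) \<in> L2"
proof -
  have eq: "(\<lambda>x. indicator {p..q} x *\<^sub>R f x) = (\<lambda>x. f x * indicator {p..q} x)"
    by (auto simp: indicator_def)
  have m: "(\<lambda>x. f x * indicator {p..q} x) \<in> borel_measurable borel"
    unfolding eq[symmetric] using assms by (intro borel_measurable_continuous_on_indicator) auto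
  then have m': "(\<lambda>x. f x * indicator {p..q} x) \<in> borel_measurable lebesgue"
    using measurable_completion[of _ lborel] by auto
  have "integrable lborel (\<lambda>x. indicator {p..q} x *\<^sub>R (cmod (f x))\<^sup>2)"
    using assms by (intro borel_integrable_compact) (auto intro!: continuous_intros)
  moreover have "(\<lambda>x. indicator {p..q} x *\<^sub>R (cmod (f x))\<^sup>2) = (\<lambda>x. (cmod (f x * indicator {p..q} x))\<^sup>2)"
    by (auto simp: indicator_def)
  ultimately have "integrable lborel (\<lambda>x. (cmod (f x * indicator {p..q} x))\<^sup>2)" by simp
  then have "integrable lebesgue (\<lambda>x. (cmod (f x * indicator {p..q} x))\<^sup>2)"
    by (subst integrable_completion) (use m in auto)
  with m' show ?thesis by (simp add: L2_def)
qed

lemma L2_norm_le_on_interval: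
  assumes "f \<in> L2" "p \<le> q" "0 \<le> B"
    and "\<And>x. x \<notin> {p..q} \<Longrightarrow> f x = 0" "\<And>x. x \<in> {p..q} \<Longrightarrow> cmod (f x) \<le> B"
  shows "(L2_norm f)\<^sup>2 \<le> B\<^sup>2 * (q - p)"
proof -
  have int: "integrable lebesgue (\<lambda>x. B\<^sup>2 * indicator {p..q} x :: real)"
    by (intro integrable_mult_right integrable_real_indicator) (auto simp: emeasure_lborel_Icc_eq)
  have "(L2_norm f)\<^sup>2 \<le> (LINT x|lebesgue. B\<^sup>2 * indicator {p..q} x)"
    unfolding L2_norm_square
    using assms by (intro integral_mono L2_integrable_norm int)
      (auto simp: indicator_def power_mono)
  also have "\<dots> = B\<^sup>2 * (q - p)" using assms by simp
  finally show ?thesis .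
qed

subsection \<open>The sampling functions\<close>

locale sampling =
  fixes T1 T2 \<epsilon> :: real
  assumes T: "0 < T1 + T2" and eps: "0 < \<epsilon>"
begin

definition lo where "lo = - T1 / (\<epsilon> * (T1 + T2))"
definition hi where "hi = T2 / (\<epsilon> * (T1 + T2))"

text \<open>The length is one full period of the exponentials. Their orthonormality and the
  identification of the two end points both rest on this.\<close>

lemma period: "hi - lo = 1 / \<epsilon>"
proof -
  have "hi - lo = (T1 + T2) / (\<epsilon> * (T1 + T2))"
    by (simp add: lo_def hi_def add_divide_distrib)
  then show ?thesis using T by simp
qed

lemma lo_less_hi: "lo < hi"
  using period eps by (smt (verit) divide_pos_pos)

abbreviation s where "s \<equiv> sampling_fun T1 T2 \<epsilon>"

definition freq :: "int \<Rightarrow> complex" where "freq l = 2 * of_real pi * \<i> * of_int l * of_real \<epsilon>"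

definition wave :: "int \<Rightarrow> real \<Rightarrow> complex" where "wave l = (\<lambda>x. exp (freq l * of_real x))"

lemma freq_add: "freq (l + m) = freq l + freq m"
  by (simp add: freq_def algebra_simps)

lemma wave_add: "wave (l + m) x = wave l x * wave m x"
  by (simp add: wave_def freq_add distrib_right exp_add)

lemma wave_0: "wave 0 x = 1"
  by (simp add: wave_def freq_def)

lemma cnj_wave: "cnj (wave l x) = wave (- l) x"
  by (simp add: wave_def freq_def exp_cnj)

lemma wave_hi: "wave l hi = wave l lo"
proof -
  have "freq l * of_real hi = freq l * of_real lo + 2 * of_real pi * \<i> * of_int l"
  proof -
    have "freq l * of_real hi - freq l * of_real lo = freq l * of_real (hi - lo)"
      by (simp add: right_diff_distrib)
    also have "\<dots> = 2 * of_real pi * \<i> * of_int l"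
      using eps by (simp add: period freq_def)
    finally show ?thesis by (simp add: algebra_simps)
  qed
  moreover have "exp (2 * of_real pi * \<i> * of_int l) = 1"
    by (simp add: exp_eq_1)
  ultimately show ?thesis by (simp add: wave_def exp_add)
qed

lemma wave_derivative:
  "(wave l has_vector_derivative freq l * wave l x) (at x within X)"
  unfolding wave_def
  by (rule has_vector_derivative_real_field[where f = "\<lambda>z. exp (freq l * z)"])
    (auto intro!: derivative_eq_intros)

lemma continuous_wave: "continuous_on X (wave l)"
  unfolding wave_def by (intro continuous_intros)

lemma s_eq: "s l x = of_real (sqrt \<epsilon>) * wave l x * indicator {lo..hi} x"
  by (simp add: sampling_fun_def wave_def freq_def lo_def hi_def)

lemma s_L2: "s l \<in> L2"
proof -
  have "(\<lambda>x. (of_real (sqrt \<epsilon>) * wave l x) * indicator {lo..hi} x) \<in> L2"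
    by (intro L2_continuous_on continuous_intros continuous_wave)
  then show ?thesis by (simp add: s_eq[abs_def])
qed

lemma freq_eq_0: "freq l = 0 \<longleftrightarrow> l = 0"
  using eps by (simp add: freq_def)

lemma s_orthonormal: "L2_inner (s l) (s m) = (if l = m then 1 else 0)"
proof -
  have *: "of_real (sqrt \<epsilon>) * (of_real (sqrt \<epsilon>) * z) = of_real \<epsilon> * z" for z :: complex
    using eps by (simp flip: of_real_mult mult.assoc)
  have "s l x * cnj (s m x) = of_real \<epsilon> * wave (l - m) x * indicator {lo..hi} x" for x
    using wave_add[of l "- m" x] *
    by (auto simp: s_eq cnj_wave indicator_def mult_ac)
  then have eq: "L2_inner (s l) (s m) = (LINT x|lebesgue. of_real \<epsilon> * wave (l - m) x * indicator {lo..hi} x)"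
    by (simp add: L2_inner_def)
  show ?thesis
  proof (cases "l = m")
    case True
    have "has_bochner_integral lebesgue (\<lambda>x. of_real \<epsilon> * indicator {lo..hi} x)
        (of_real \<epsilon> * of_real hi - of_real \<epsilon> * of_real lo :: complex)"
      using lo_less_hi
      by (intro has_bochner_integral_lebesgue_FTC) (auto intro!: derivative_eq_intros)
    moreover have "of_real \<epsilon> * of_real hi - of_real \<epsilon> * of_real lo = (1::complex)"
      using eps period by (simp flip: of_real_mult of_real_diff right_diff_distrib)
    ultimately show ?thesis
      using True eq by (simp add: has_bochner_integral_iff wave_0)
  next
    case False
    define c where "c = freq (l - m)"
    have c: "c \<noteq> 0" using False by (simp add: c_def freq_eq_0)
    have "has_bochner_integral lebesgue (\<lambda>x. of_real \<epsilon> * wave (l - m) x * indicator {lo..hi} x)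
        (of_real \<epsilon> / c * wave (l - m) hi - of_real \<epsilon> / c * wave (l - m) lo)"
    proof (rule has_bochner_integral_lebesgue_FTC)
      fix x
      have "((\<lambda>x. of_real \<epsilon> / c * wave (l - m) x) has_vector_derivative
          of_real \<epsilon> / c * (freq (l - m) * wave (l - m) x)) (at x within {lo..hi})"
        by (intro has_vector_derivative_mult_right wave_derivative)
      then show "((\<lambda>x. of_real \<epsilon> / c * wave (l - m) x) has_vector_derivative
          of_real \<epsilon> * wave (l - m) x) (at x within {lo..hi})"
        using c by (simp add: c_def)
    qed (use lo_less_hi in \<open>auto intro!: continuous_intros continuous_wave\<close>)
    then show ?thesis
      using False eq by (simp add: has_bochner_integral_iff wave_hi)
  qed
qed

sublocale L2_orthonormal s
  by unfold_locales (auto simp: s_L2 s_orthonormal)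

subsection \<open>Uniform approximation by trigonometric polynomials\<close>

text \<open>Trigonometric polynomials form an algebra because frequencies add under multiplication;
  each factor is treated by its own span induction.\<close>

lemma span_wave_mult:
  assumes "u \<in> cfun_span (range wave)" "v \<in> cfun_span (range wave)"
  shows "(\<lambda>x. u x * v x) \<in> cfun_span (range wave)"
proof -
  have 1: "(\<lambda>x. wave l x * v x) \<in> cfun_span (range wave)" for l
    using assms(2)
  proof (induction rule: cfun.span_induct_alt)
    case base
    show ?case using cfun.span_zero by (simp add: zero_fun_def)
  next
    case (step c w y)
    then obtain m where m: "w = wave m" by auto
    have "wave (l + m) \<in> cfun_span (range wave)" by (intro cfun.span_base) auto
    with step have "fscale c (wave (l + m)) + (\<lambda>x. wave l x * y x) \<in> cfun_span (range wave)"
      by (intro cfun.span_add cfun.span_scale)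
    moreover have "fscale c (wave (l + m)) + (\<lambda>x. wave l x * y x) = (\<lambda>x. wave l x * (fscale c w + y) x)"
      by (auto simp: fun_eq_iff fscale_def m wave_add algebra_simps)
    ultimately show ?case by simp
  qed
  show ?thesis
    using assms(1)
  proof (induction rule: cfun.span_induct_alt)
    case base
    show ?case using cfun.span_zero by (simp add: zero_fun_def)
  next
    case (step c w y)
    have "fscale c (\<lambda>x. w x * v x) + (\<lambda>x. y x * v x) \<in> cfun_span (range wave)"
      using step 1 by (intro cfun.span_add cfun.span_scale) auto
    moreover have "fscale c (\<lambda>x. w x * v x) + (\<lambda>x. y x * v x) = (\<lambda>x. (fscale c w + y) x * v x)"
      by (auto simp: fun_eq_iff fscale_def algebra_simps)
    ultimately show ?case by simp
  qed
qed

lemma span_wave_scale: "u \<in> cfun_span (range wave) \<Longrightarrow> (\<lambda>x. c * u x) \<in> cfun_span (range wave)"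
  using cfun.span_scale[of u "range wave" c] by (simp add: fscale_def)

lemma span_wave_add:
  "u \<in> cfun_span (range wave) \<Longrightarrow> v \<in> cfun_span (range wave) \<Longrightarrow>
    (\<lambda>x. u x + v x) \<in> cfun_span (range wave)"
  using cfun.span_add[of u "range wave" v] by (simp add: plus_fun_def)

lemma span_wave_wave: "wave l \<in> cfun_span (range wave)"
  by (intro cfun.span_base) auto

lemma span_wave_const: "(\<lambda>x. c) \<in> cfun_span (range wave)"
  using span_wave_scale[OF span_wave_wave[of 0], of c] by (simp add: wave_0)

text \<open>A real polynomial in Re z and Im z becomes a trigonometric polynomial on the circle,
  since Re z and Im z are combinations of z and \<open>cnj z\<close>, and
  \<open>cnj (wave 1 x) = wave (- 1) x\<close>.\<close>

lemma real_polynomial_wave: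
  fixes p :: "complex \<Rightarrow> real"
  assumes "real_polynomial_function p"
  shows "(\<lambda>x. of_real (p (wave 1 x))) \<in> cfun_span (range wave)"
  using assms
proof induction
  case (linear f)
  interpret bounded_linear f by fact
  have f: "f z = Re z * f 1 + Im z * f \<i>" for z
  proof -
    have "f z = f (Re z *\<^sub>R 1 + Im z *\<^sub>R \<i>)"
      by (rule arg_cong[where f = f]) (simp add: complex_eq_iff)
    then show ?thesis by (simp add: add scale)
  qed
  have f': "of_real (f z) = of_real (f 1) * (1 / 2 * (z + cnj z)) + of_real (f \<i>) * (- \<i> / 2 * (z + - 1 * cnj z))" for z
    by (subst f[of z]) (simp add: complex_eq_iff)
  have "(\<lambda>x. of_real (f (wave 1 x)) :: complex) =
    (\<lambda>x. of_real (f 1) * (1 / 2 * (wave 1 x + wave (- 1) x)) +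
         of_real (f \<i>) * (- \<i> / 2 * (wave 1 x + - 1 * wave (- 1) x)))"
    using f'[of "wave 1 _"] unfolding cnj_wave by blast
  also have "\<dots> \<in> cfun_span (range wave)"
    by (intro span_wave_add span_wave_scale span_wave_wave)
  finally show ?case .
next
  case (const c)
  show ?case by (rule span_wave_const)
next
  case (add f g)
  then show ?case using span_wave_add by simp
next
  case (mult f g)
  then show ?case using span_wave_mult by simp
qed

text \<open>Only finitely many frequencies occur, and on \<open>{lo..hi}\<close> a wave is a
  sampling function divided by \<open>sqrt \<epsilon>\<close>.\<close>

lemma span_wave_finite:
  assumes "u \<in> cfun_span (range wave)"
  obtains L where "0 \<le> L" "(\<lambda>x. u x * indicator {lo..hi} x) \<in> cfun_span (s ` {- L..L})"
proof -
  have "\<exists>L\<ge>0. (\<lambda>x. u x * indicator {lo..hi} x) \<in> cfun_span (s ` {- L..L})"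
    using assms
  proof (induction rule: cfun.span_induct_alt)
    case base
    have "(\<lambda>x. 0) \<in> cfun_span (s ` {- 0..0})" using cfun.span_zero by (simp add: zero_fun_def)
    then show ?case by auto
  next
    case (step c w y)
    then obtain L where L: "0 \<le> L" "(\<lambda>x. y x * indicator {lo..hi} x) \<in> cfun_span (s ` {- L..L})"
      by auto
    from step obtain m where m: "w = wave m" by auto
    define M where "M = max L \<bar>m\<bar>"
    have "(\<lambda>x. y x * indicator {lo..hi} x) \<in> cfun_span (s ` {- M..M})"
      by (rule set_mp[OF cfun.span_mono L(2)], rule image_mono) (auto simp: M_def)
    moreover have "s m \<in> cfun_span (s ` {- M..M})"
      by (intro cfun.span_base imageI) (auto simp: M_def)
    ultimately have "fscale (c / of_real (sqrt \<epsilon>)) (s m) + (\<lambda>x. y x * indicator {lo..hi} x)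
        \<in> cfun_span (s ` {- M..M})"
      by (intro cfun.span_add cfun.span_scale)
    moreover have "fscale (c / of_real (sqrt \<epsilon>)) (s m) + (\<lambda>x. y x * indicator {lo..hi} x)
        = (\<lambda>x. (fscale c w + y) x * indicator {lo..hi} x)"
      using eps by (auto simp: fun_eq_iff fscale_def s_eq m algebra_simps)
    moreover have "0 \<le> M" using L by (simp add: M_def)
    ultimately show ?case by auto
  qed
  then show thesis using that by blast
qed

text \<open>Since the interval is one full period, it is a quotient of the compact interval onto the
  circle, and a function with equal values at the two end points descends to the circle.\<close>

lemma trigonometric_approximation:
  assumes h: "continuous_on {lo..hi} h" "h lo = h hi" and "0 < \<eta>"
  obtains L t where "0 \<le> L" "t \<in> cfun_span (s ` {- L..L})"
    and "\<And>x. x \<in> {lo..hi} \<Longrightarrow> cmod (h x - t x) < \<eta>"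
proof -
  define C where "C = wave 1 ` {lo..hi}"
  \<comment> \<open>The descent of \<open>h\<close> to the circle \<open>C\<close>; by
    \<open>fiber\<close> the choice of the preimage does not matter.\<close>
  define G where "G z = h (SOME x. x \<in> {lo..hi} \<and> wave 1 x = z)" for z
  \<comment> \<open>Equal waves make \<epsilon> (x - y) an integer, and the length 1/\<epsilon>
    bounds it by 1 in absolute value. So x = y, or x and y are the two end points, where
    \<open>h\<close> agrees.\<close>
  have fiber: "h x = h y" if xy: "x \<in> {lo..hi}" "y \<in> {lo..hi}" "wave 1 x = wave 1 y" for x y
  proof -
    obtain n :: int where "freq 1 * of_real x = freq 1 * of_real y + of_int (2 * n) * of_real pi * \<i>"
      using xy(3) unfolding wave_def exp_eq by auto
    then have "2 * of_real pi * \<i> * of_real (\<epsilon> * (x - y)) = 2 * of_real pi * \<i> * (of_int n :: complex)"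
      by (simp add: freq_def algebra_simps)
    then have "of_real (\<epsilon> * (x - y)) = (of_int n :: complex)" by simp
    then have "of_real (\<epsilon> * (x - y)) = (of_real (of_int n) :: complex)" by simp
    then have n: "\<epsilon> * (x - y) = of_int n" unfolding of_real_eq_iff .
    have "\<bar>x - y\<bar> \<le> hi - lo" using xy by auto
    then have "\<epsilon> * \<bar>x - y\<bar> \<le> 1" using eps by (simp add: period field_simps)
    moreover have "\<epsilon> * \<bar>x - y\<bar> = \<bar>\<epsilon> * (x - y)\<bar>" using eps by (simp add: abs_mult)
    ultimately have "\<bar>of_int n :: real\<bar> \<le> 1" using n by simp
    then have "\<bar>n\<bar> \<le> 1" by linarith
    then consider "n = 0" | "n = 1" | "n = -1" by linarith
    then show ?thesis
    proof cases
      case 1 with n eps show ?thesis by simp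
    next
      case 2
      with n eps have "x - y = hi - lo" by (simp add: period field_simps)
      then show ?thesis using xy h(2) by (smt (verit) atLeastAtMost_iff)
    next
      case 3
      with n eps have "y - x = hi - lo" by (simp add: period field_simps)
      then show ?thesis using xy h(2) by (smt (verit) atLeastAtMost_iff)
    qed
  qed
  have G: "G (wave 1 x) = h x" if "x \<in> {lo..hi}" for x
  proof -
    let ?y = "SOME y. y \<in> {lo..hi} \<and> wave 1 y = wave 1 x"
    have "?y \<in> {lo..hi} \<and> wave 1 ?y = wave 1 x" by (rule someI) (use that in auto)
    then show ?thesis unfolding G_def using fiber that by blast
  qed
  \<comment> \<open>The preimage of a closed set B under \<open>G\<close> is the image under
    \<open>wave 1\<close> of the compact part of the interval on which \<open>h\<close> lies in B;
    hence it is closed.\<close>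
  have "continuous_on C G"
    unfolding continuous_on_closed_invariant
  proof (intro allI impI)
    fix B :: "complex set" assume "closed B"
    have "closed ({lo..hi} \<inter> h -` B)"
      using h(1) \<open>closed B\<close> by (intro continuous_closed_preimage) auto
    then have "compact ({lo..hi} \<inter> h -` B)"
      by (metis Int_absorb2 Int_lower1 closed_Int_compact compact_Icc inf_commute)
    then have "compact (wave 1 ` ({lo..hi} \<inter> h -` B))"
      by (intro compact_continuous_image continuous_wave)
    then have "closed (wave 1 ` ({lo..hi} \<inter> h -` B))" by (rule compact_imp_closed)
    moreover have "wave 1 ` ({lo..hi} \<inter> h -` B) = G -` B \<inter> C"
    proof (intro equalityI subsetI)
      fix z assume "z \<in> wave 1 ` ({lo..hi} \<inter> h -` B)"
      then show "z \<in> G -` B \<inter> C" using G by (auto simp: C_def)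
    next
      fix z assume "z \<in> G -` B \<inter> C"
      then obtain x where "x \<in> {lo..hi}" "z = wave 1 x" "G z \<in> B" by (auto simp: C_def)
      then show "z \<in> wave 1 ` ({lo..hi} \<inter> h -` B)" using G[of x] by (auto simp: C_def)
    qed
    ultimately show "\<exists>A. closed A \<and> A \<inter> C = G -` B \<inter> C" by (metis Int_absorb2 Int_lower2)
  qed
  moreover have "compact C"
    unfolding C_def by (intro compact_continuous_image continuous_wave) auto
  ultimately obtain g where g: "polynomial_function g" "\<And>z. z \<in> C \<Longrightarrow> cmod (G z - g z) < \<eta>"
    using Stone_Weierstrass_polynomial_function[of C G \<eta>] \<open>0 < \<eta>\<close> by auto
  have "real_polynomial_function (\<lambda>z. Re (g z))" "real_polynomial_function (\<lambda>z. Im (g z))"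
    using g(1) bounded_linear_Re bounded_linear_Im unfolding polynomial_function_def o_def by auto
  then have "(\<lambda>x. of_real (Re (g (wave 1 x))) + \<i> * of_real (Im (g (wave 1 x)))) \<in> cfun_span (range wave)"
    by (intro span_wave_add span_wave_scale real_polynomial_wave)
  then have "(\<lambda>x. g (wave 1 x)) \<in> cfun_span (range wave)" by (simp flip: complex_eq)
  then obtain L where L: "0 \<le> L"
      "(\<lambda>x. g (wave 1 x) * indicator {lo..hi} x) \<in> cfun_span (s ` {- L..L})"
    by (rule span_wave_finite)
  have "cmod (h x - g (wave 1 x) * indicator {lo..hi} x) < \<eta>" if "x \<in> {lo..hi}" for x
    using g(2)[of "wave 1 x"] G[OF that] that by (simp add: C_def)
  with L show thesis by (rule that)
qed

text \<open>In use, \<open>d\<close> is a rescaled derivative of \<open>h\<close> and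
  \<open>\<kappa>\<close> comes from dividing by the frequency. Bessel's inequality for
  \<open>d\<close> bounds every finite part of the tail, and density leaves an error \<delta> that
  is arbitrary; Parseval's identity is thus avoided.\<close>

lemma residual_le:
  assumes h: "continuous_on {lo..hi} h" "h lo = h hi"
  defines "H \<equiv> \<lambda>x. h x * indicator {lo..hi} x"
  assumes A: "finite A" and d: "d \<in> L2"
    and decay: "\<And>l. l \<notin> A \<Longrightarrow> cmod (L2_inner H (s l)) \<le> \<kappa> * cmod (L2_inner d (s l))"
  shows "(L2_norm (\<lambda>x. H x - part A H x))\<^sup>2 \<le> \<kappa>\<^sup>2 * (L2_norm d)\<^sup>2"
proof (rule field_le_epsilon)
  fix \<delta> :: real assume "0 < \<delta>"
  \<comment> \<open>A uniform error \<eta> on an interval of length 1/\<epsilon> has squared L2 norm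
    at most \<eta>^2/\<epsilon> = \<delta>.\<close>
  define \<eta> where "\<eta> = sqrt (\<epsilon> * \<delta>)"
  have \<eta>: "0 < \<eta>" "\<eta>\<^sup>2 = \<epsilon> * \<delta>" using eps \<open>0 < \<delta>\<close> by (auto simp: \<eta>_def)
  obtain L t where L: "0 \<le> L" and t: "t \<in> cfun_span (s ` {- L..L})"
    and ht: "\<And>x. x \<in> {lo..hi} \<Longrightarrow> cmod (h x - t x) < \<eta>"
    using trigonometric_approximation[OF h \<eta>(1)] by metis
  \<comment> \<open>Containing \<open>A\<close> allows the residual to be split; containing the
    frequencies of \<open>t\<close> makes \<open>t\<close> a competitor for best
    approximation.\<close>
  define B where "B = A \<union> {- L..L}"
  have B: "finite B" using A by (simp add: B_def)
  have HL2: "H \<in> L2" unfolding H_def by (intro L2_continuous_on h)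
  have tB: "t \<in> cfun_span (s ` B)"
    by (rule set_mp[OF cfun.span_mono t]) (auto simp: B_def)
  have tL2: "t \<in> L2" using tB B by (rule span_L2)
  obtain c where c: "t = (\<lambda>x. \<Sum>i\<in>B. c i * s i x)" using tB B by (rule span_form)
  have tout: "t x = 0" if "x \<notin> {lo..hi}" for x using that by (auto simp: c s_eq)
  have "(L2_norm (\<lambda>x. H x - part B H x))\<^sup>2 \<le> (L2_norm (\<lambda>x. H x - t x))\<^sup>2"
    using B HL2 tB by (intro best_approximation inner_residual_span) (auto simp: part_def sum_in_span)
  also have "\<dots> \<le> \<eta>\<^sup>2 * (hi - lo)"
    using lo_less_hi \<eta> ht tout
    by (intro L2_norm_le_on_interval L2_diff HL2 tL2) (auto simp: H_def intro: less_imp_le)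
  also have "\<dots> = \<delta>" using eps by (simp add: \<eta> period)
  finally have 1: "(L2_norm (\<lambda>x. H x - part B H x))\<^sup>2 \<le> \<delta>" .
  have "(\<Sum>i\<in>B - A. (cmod (L2_inner H (s i)))\<^sup>2) \<le> (\<Sum>i\<in>B - A. \<kappa>\<^sup>2 * (cmod (L2_inner d (s i)))\<^sup>2)"
    unfolding power_mult_distrib[symmetric] using decay by (intro sum_mono power_mono) auto
  also have "\<dots> = \<kappa>\<^sup>2 * (\<Sum>i\<in>B - A. (cmod (L2_inner d (s i)))\<^sup>2)" by (simp add: sum_distrib_left)
  also have "\<dots> \<le> \<kappa>\<^sup>2 * (L2_norm d)\<^sup>2" using B d by (intro mult_left_mono bessel) auto
  finally have 2: "(\<Sum>i\<in>B - A. (cmod (L2_inner H (s i)))\<^sup>2) \<le> \<kappa>\<^sup>2 * (L2_norm d)\<^sup>2" .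
  have "(L2_norm (\<lambda>x. H x - part A H x))\<^sup>2
    = (L2_norm (\<lambda>x. H x - part B H x))\<^sup>2 + (\<Sum>i\<in>B - A. (cmod (L2_inner H (s i)))\<^sup>2)"
    using B HL2 by (intro residual_antimono) (auto simp: B_def)
  with 1 2 show "(L2_norm (\<lambda>x. H x - part A H x))\<^sup>2 \<le> \<kappa>\<^sup>2 * (L2_norm d)\<^sup>2 + \<delta>" by simp
qed

end

subsection \<open>Superpositions of translates of a compactly supported function\<close>

text \<open>Bounds the overlap at the point y: the admissible k are integers in [y - a, y].\<close>

lemma card_translates_le:
  assumes "finite K" "0 \<le> a" "\<And>k. k \<in> K \<Longrightarrow> 0 \<le> y - of_int k \<and> y - of_int k \<le> a"
  shows "real (card K) \<le> a + 1"
proof -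
  have "K \<subseteq> {\<lceil>y - a\<rceil>..\<lfloor>y\<rfloor>}"
  proof
    fix k assume "k \<in> K"
    from assms(3)[OF this] show "k \<in> {\<lceil>y - a\<rceil>..\<lfloor>y\<rfloor>}"
      by (auto simp: ceiling_le_iff le_floor_iff)
  qed
  then have "card K \<le> nat (\<lfloor>y\<rfloor> - \<lceil>y - a\<rceil> + 1)"
    using card_mono[of "{\<lceil>y - a\<rceil>..\<lfloor>y\<rfloor>}" K] by simp
  then have "real (card K) \<le> max 0 (of_int (\<lfloor>y\<rfloor> - \<lceil>y - a\<rceil> + 1))" by linarith
  also have "\<dots> \<le> a + 1" using assms(2) by (simp, linarith)
  finally show ?thesis .
qed

text \<open>Translates of u need not be orthogonal, but at each point at most a + 1 of them are
  nonzero, so Cauchy-Schwarz costs a factor a + 1 independent of b and K. The factor 1/b is the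
  effect of dilation. Applied to the error \<phi> - g and to the derivative g', both cut off to
  [0, a].\<close>

lemma norm_sum_translates:
  fixes u :: "real \<Rightarrow> complex"
  assumes u: "u \<in> L2" "\<And>x. x \<notin> {0..a} \<Longrightarrow> u x = 0" and "0 \<le> a" "0 < b" "finite K"
  shows "(\<lambda>x. \<Sum>k\<in>K. \<alpha> k * u (b * x - of_int k)) \<in> L2"
    and "(L2_norm (\<lambda>x. \<Sum>k\<in>K. \<alpha> k * u (b * x - of_int k)))\<^sup>2
      \<le> (a + 1) / b * (\<Sum>k\<in>K. (cmod (\<alpha> k))\<^sup>2) * (L2_norm u)\<^sup>2"
proof -
  have 1: "(\<lambda>x. u (b * x - of_int k)) \<in> L2"
    "(L2_norm (\<lambda>x. u (b * x - of_int k)))\<^sup>2 = (L2_norm u)\<^sup>2 / b" for k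
    using L2_affine[OF u(1), of b "- of_int k"] \<open>0 < b\<close> by (auto simp: field_simps)
  have ak: "(\<lambda>x. \<alpha> k * u (b * x - of_int k)) \<in> L2" for k by (intro L2_scale 1)
  show S: "(\<lambda>x. \<Sum>k\<in>K. \<alpha> k * u (b * x - of_int k)) \<in> L2"
    by (intro L2_sum L2_scale 1)
  have pointwise: "(cmod (\<Sum>k\<in>K. \<alpha> k * u (b * x - of_int k)))\<^sup>2
      \<le> (a + 1) * (\<Sum>k\<in>K. (cmod (\<alpha> k * u (b * x - of_int k)))\<^sup>2)" for x
  proof -
    define K' where "K' = {k \<in> K. b * x - of_int k \<in> {0..a}}"
    have K': "finite K'" "K' \<subseteq> K" using \<open>finite K\<close> by (auto simp: K'_def)
    have out: "u (b * x - of_int k) = 0" if "k \<in> K - K'" for k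
      using that by (intro u(2)) (auto simp: K'_def)
    have card: "real (card K') \<le> a + 1"
      using K'(1) \<open>0 \<le> a\<close> by (rule card_translates_le[where y = "b * x"]) (auto simp: K'_def)
    have "(\<Sum>k\<in>K. \<alpha> k * u (b * x - of_int k)) = (\<Sum>k\<in>K'. \<alpha> k * u (b * x - of_int k))"
      using \<open>finite K\<close> K' out by (intro sum.mono_neutral_right) auto
    then have "(cmod (\<Sum>k\<in>K. \<alpha> k * u (b * x - of_int k)))\<^sup>2
        \<le> (\<Sum>k\<in>K'. cmod (\<alpha> k * u (b * x - of_int k)))\<^sup>2"
      by (simp add: norm_sum power_mono)
    also have "\<dots> \<le> (\<Sum>k\<in>K'. (cmod (\<alpha> k * u (b * x - of_int k)))\<^sup>2) * card K'"
      by (rule sum_squared_le_sum_of_squares)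
    also have "\<dots> \<le> (\<Sum>k\<in>K. (cmod (\<alpha> k * u (b * x - of_int k)))\<^sup>2) * (a + 1)"
      using K' \<open>finite K\<close> card by (intro mult_mono sum_mono2) (auto intro: sum_nonneg)
    finally show ?thesis by (simp add: mult.commute)
  qed
  have int: "integrable lebesgue (\<lambda>x. (cmod (\<alpha> k * u (b * x - of_int k)))\<^sup>2)" for k
    using ak by (rule L2_integrable_norm)
  have "(L2_norm (\<lambda>x. \<Sum>k\<in>K. \<alpha> k * u (b * x - of_int k)))\<^sup>2
      \<le> (LINT x|lebesgue. (a + 1) * (\<Sum>k\<in>K. (cmod (\<alpha> k * u (b * x - of_int k)))\<^sup>2))"
    unfolding L2_norm_square
    by (intro integral_mono L2_integrable_norm S integrable_mult_right
        Bochner_Integration.integrable_sum int pointwise)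
  also have "\<dots> = (a + 1) * (\<Sum>k\<in>K. LINT x|lebesgue. (cmod (\<alpha> k * u (b * x - of_int k)))\<^sup>2)"
    by (subst integral_mult_right_zero, subst Bochner_Integration.integral_sum) (auto intro: int)
  also have "\<dots> = (a + 1) * (\<Sum>k\<in>K. (cmod (\<alpha> k))\<^sup>2 * ((L2_norm u)\<^sup>2 / b))"
    by (simp only: norm_mult power_mult_distrib integral_mult_right_zero 1(2) flip: L2_norm_square)
  also have "\<dots> = (a + 1) / b * (\<Sum>k\<in>K. (cmod (\<alpha> k))\<^sup>2) * (L2_norm u)\<^sup>2"
    by (simp add: sum_distrib_left mult_ac flip: sum_divide_distrib)
  finally show "(L2_norm (\<lambda>x. \<Sum>k\<in>K. \<alpha> k * u (b * x - of_int k)))\<^sup>2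
      \<le> (a + 1) / b * (\<Sum>k\<in>K. (cmod (\<alpha> k))\<^sup>2) * (L2_norm u)\<^sup>2" .
qed

subsection \<open>Approximation by continuously differentiable functions\<close>

text \<open>The nearest point in the ball of radius m is at distance at most |\<phi> x| from \<phi>
  x, since 0 lies in the ball, so dominated convergence applies. Boundedness is wanted as the source
  of a dominating function in the next approximation.\<close>

lemma L2_truncation:
  fixes \<phi> :: "real \<Rightarrow> complex"
  assumes "\<phi> \<in> L2" "0 < \<delta>"
  obtains m :: nat where "0 < m" "(\<lambda>x. closest_point (cball 0 (real m)) (\<phi> x)) \<in> L2"
    and "(L2_norm (\<lambda>x. \<phi> x - closest_point (cball 0 (real m)) (\<phi> x)))\<^sup>2 < \<delta>"
proof -
  let ?c = "\<lambda>m::nat. closest_point (cball (0::complex) (real m))"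
  have [measurable]: "\<phi> \<in> borel_measurable lebesgue" using assms by (simp add: L2_def)
  have "continuous_on UNIV (?c m)" for m
    by (rule continuous_on_closest_point) auto
  then have [measurable]: "?c m \<in> borel_measurable borel" for m
    by (rule borel_measurable_continuous_onI)
  have cL2: "(\<lambda>x. ?c m (\<phi> x)) \<in> L2" for m
  proof (rule L2_dominated[OF assms(1)])
    show "cmod (?c m (\<phi> x)) \<le> cmod (\<phi> x)" for x
      using closest_point_lipschitz[of "cball (0::complex) (real m)" "\<phi> x" 0]
        closest_point_self[of 0 "cball (0::complex) (real m)"]
      by (simp add: dist_norm)
  qed measurable
  have "(\<lambda>m. LINT x|lebesgue. (cmod (\<phi> x - ?c m (\<phi> x)))\<^sup>2) \<longlonglongrightarrow> integral\<^sup>L lebesgue (\<lambda>x::real. 0::real)"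
  proof (rule integral_dominated_convergence[where w = "\<lambda>x. (cmod (\<phi> x))\<^sup>2"])
    show "AE x in lebesgue. (\<lambda>m. (cmod (\<phi> x - ?c m (\<phi> x)))\<^sup>2) \<longlonglongrightarrow> 0"
    proof (rule AE_I2)
      fix x
      have "\<forall>\<^sub>F m in sequentially. cmod (\<phi> x) \<le> real m"
        using filterlim_real_sequentially by (simp add: filterlim_at_top)
      then have "\<forall>\<^sub>F m in sequentially. (cmod (\<phi> x - ?c m (\<phi> x)))\<^sup>2 = 0"
        by eventually_elim (simp add: closest_point_self)
      then show "(\<lambda>m. (cmod (\<phi> x - ?c m (\<phi> x)))\<^sup>2) \<longlonglongrightarrow> 0" by (rule tendsto_eventually)
    qed
    show "AE x in lebesgue. norm ((cmod (\<phi> x - ?c m (\<phi> x)))\<^sup>2) \<le> (cmod (\<phi> x))\<^sup>2" for m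
      using closest_point_le[of "cball (0::complex) (real m)" 0 "\<phi> _"]
      by (intro AE_I2) (auto simp: dist_norm power_mono)
    show "integrable lebesgue (\<lambda>x. (cmod (\<phi> x))\<^sup>2)" using assms by (intro L2_integrable_norm)
  qed (use cL2 in \<open>auto intro!: borel_measurable_integrable L2_integrable_norm L2_diff assms\<close>)
  then have "\<forall>\<^sub>F m in sequentially. (LINT x|lebesgue. (cmod (\<phi> x - ?c m (\<phi> x)))\<^sup>2) < \<delta>"
    using assms(2) by (intro order_tendstoD) auto
  then have "\<forall>\<^sub>F m in sequentially. 0 < m \<and> (L2_norm (\<lambda>x. \<phi> x - ?c m (\<phi> x)))\<^sup>2 < \<delta>"
    using eventually_gt_at_top[of 0] unfolding L2_norm_square by eventually_elim simp
  then obtain m where "0 < m" "(L2_norm (\<lambda>x. \<phi> x - ?c m (\<phi> x)))\<^sup>2 < \<delta>"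
    unfolding eventually_sequentially by blast
  with cL2 show thesis using that by blast
qed

text \<open>A measurable function is an almost everywhere limit of continuous ones. Clipping these
  to the ball of radius m makes them uniformly bounded, a ramp forces the zeros at 0 and a, and both
  changes disappear in the limit.\<close>

lemma L2_continuous_approximation:
  fixes f :: "real \<Rightarrow> complex"
  assumes f: "f \<in> L2" "\<And>x. cmod (f x) \<le> m" and "0 < a" "0 < \<delta>"
  obtains h where "continuous_on {0..a} h" "h 0 = 0" "h a = 0"
    and "(L2_norm (\<lambda>x. (f x - h x) * indicator {0..a} x))\<^sup>2 < \<delta>"
proof -
  have m: "0 \<le> m" using f(2)[of 0] norm_ge_zero order_trans by blast
  have "f measurable_on UNIV"
    using f(1) by (intro lebesgue_measurable_imp_measurable_on) (auto simp: L2_def)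
  then obtain N g where N: "negligible N" and g: "\<And>n. continuous_on UNIV (g n)"
    and lim: "\<And>x. x \<notin> N \<Longrightarrow> (\<lambda>n. g n x) \<longlonglongrightarrow> f x"
    unfolding measurable_on_def by auto
  define c where "c = closest_point (cball (0::complex) m)"
  have c_cont: "continuous_on UNIV c"
    unfolding c_def using m by (intro continuous_on_closest_point) auto
  have c_le: "cmod (c z) \<le> m" for z
    using closest_point_in_set[of "cball (0::complex) m" z] m by (simp add: c_def)
  have c_f: "c (f x) = f x" for x using f(2) by (simp add: c_def closest_point_self)
  \<comment> \<open>A trapezoid: 0 at both ends, and equal to 1 at each interior point once n is
    large.\<close>
  define r where "r n x = min 1 (min (real n * x) (real n * (a - x)))" for n x
  have r01: "0 \<le> r n x" "r n x \<le> 1" if "x \<in> {0..a}" for n x using that by (auto simp: r_def)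
  have r_cont: "continuous_on X (r n)" for X n unfolding r_def by (intro continuous_intros)
  define h where "h n x = c (g n x) * of_real (r n x)" for n x
  have h_cont: "continuous_on X (h n)" for X n
  proof -
    have "continuous_on X (\<lambda>x. c (g n x))"
      using continuous_on_compose2[OF c_cont g] continuous_on_subset by blast
    then show ?thesis unfolding h_def by (intro continuous_intros r_cont)
  qed
  have h_le: "cmod (h n x) \<le> m" if "x \<in> {0..a}" for n x
  proof -
    have "cmod (c (g n x)) * \<bar>r n x\<bar> \<le> m * 1"
      using r01[OF that] m by (intro mult_mono c_le) auto
    then show ?thesis by (simp add: h_def norm_mult)
  qed
  have L2: "(\<lambda>x. (f x - h n x) * indicator {0..a} x) \<in> L2" for n
    using L2_diff[OF L2_restrict[OF f(1)] L2_continuous_on[OF h_cont]] by (simp add: left_diff_distrib)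
  have "(\<lambda>n. LINT x|lebesgue. (cmod ((f x - h n x) * indicator {0..a} x))\<^sup>2)
      \<longlonglongrightarrow> integral\<^sup>L lebesgue (\<lambda>x::real. 0::real)"
  proof (rule integral_dominated_convergence[where w = "\<lambda>x. (2 * m)\<^sup>2 * indicator {0..a} x"])
    \<comment> \<open>The end points are excluded as well, because the ramp stays 0 there.\<close>
    have "AE x in lebesgue. x \<notin> N \<union> {0, a}"
    proof (rule AE_not_in)
      have "negligible (N \<union> {0, a})" using N by (intro negligible_Un) auto
      then show "N \<union> {0, a} \<in> null_sets lebesgue" by (simp add: negligible_iff_null_sets)
    qed
    then show "AE x in lebesgue. (\<lambda>n. (cmod ((f x - h n x) * indicator {0..a} x))\<^sup>2) \<longlonglongrightarrow> 0"
    proof eventually_elim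
      case (elim x)
      show ?case
      proof (cases "x \<in> {0..a}")
        case True
        then have x: "0 < x" "0 < a - x" using elim by auto
        have "(\<lambda>n. c (g n x)) \<longlonglongrightarrow> c (f x)"
          using c_cont lim[of x] elim
          by (intro continuous_on_tendsto_compose[where f = c and s = UNIV]) auto
        moreover have "(\<lambda>n. r n x) \<longlonglongrightarrow> 1"
        proof (rule tendsto_eventually)
          have "\<forall>\<^sub>F n in sequentially. max (1 / x) (1 / (a - x)) \<le> real n"
            using filterlim_real_sequentially unfolding filterlim_at_top by blast
          then show "\<forall>\<^sub>F n in sequentially. r n x = 1"
            by eventually_elim (use x in \<open>auto simp: r_def field_simps min_def\<close>)
        qed
        ultimately have "(\<lambda>n. h n x) \<longlonglongrightarrow> c (f x) * of_real 1"
          unfolding h_def by (intro tendsto_mult tendsto_of_real)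
        then have "(\<lambda>n. (cmod (f x - h n x))\<^sup>2) \<longlonglongrightarrow> (cmod (f x - f x))\<^sup>2"
          by (intro tendsto_intros) (simp add: c_f)
        then show ?thesis using True by simp
      qed simp
    qed
    show "AE x in lebesgue. norm ((cmod ((f x - h n x) * indicator {0..a} x))\<^sup>2)
        \<le> (2 * m)\<^sup>2 * indicator {0..a} x" for n
    proof (rule AE_I2)
      fix x
      have "cmod (f x - h n x) \<le> 2 * m" if "x \<in> {0..a}"
        using norm_triangle_ineq4[of "f x" "h n x"] f(2)[of x] h_le[OF that, of n] by linarith
      then show "norm ((cmod ((f x - h n x) * indicator {0..a} x))\<^sup>2) \<le> (2 * m)\<^sup>2 * indicator {0..a} x"
        using power_mono[of "cmod (f x - h n x)" "2 * m" 2] by (auto simp: indicator_def)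
    qed
    show "integrable lebesgue (\<lambda>x. (2 * m)\<^sup>2 * indicator {0..a} x :: real)"
      by (intro integrable_mult_right integrable_real_indicator) (auto simp: emeasure_lborel_Icc_eq)
  qed (use L2 in \<open>auto intro!: borel_measurable_integrable L2_integrable_norm\<close>)
  then have "\<forall>\<^sub>F n in sequentially. (LINT x|lebesgue. (cmod ((f x - h n x) * indicator {0..a} x))\<^sup>2) < \<delta>"
    using \<open>0 < \<delta>\<close> by (intro order_tendstoD) auto
  then obtain n where "(LINT x|lebesgue. (cmod ((f x - h n x) * indicator {0..a} x))\<^sup>2) < \<delta>"
    unfolding eventually_sequentially by blast
  then have "(L2_norm (\<lambda>x. (f x - h n x) * indicator {0..a} x))\<^sup>2 < \<delta>"
    by (simp add: L2_norm_square)
  moreover have "h n 0 = 0" "h n a = 0" using \<open>0 < a\<close> by (auto simp: h_def r_def)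
  ultimately show thesis using that h_cont by blast
qed

text \<open>Weierstrass gives p within \<eta> of h but not the zeros at the ends. Subtracting the
  affine interpolant of p at 0 and a restores them; it is a convex combination of two values below
  \<eta>, hence the total 3 \<eta>.\<close>

lemma polynomial_approximation_vanishing:
  fixes h :: "real \<Rightarrow> complex"
  assumes h: "continuous_on {0..a} h" "h 0 = 0" "h a = 0" and "0 < a" "0 < \<eta>"
  obtains g g' where "\<And>x. (g has_vector_derivative g' x) (at x)" "continuous_on UNIV g'"
    and "g 0 = 0" "g a = 0" "\<And>x. x \<in> {0..a} \<Longrightarrow> cmod (h x - g x) \<le> 3 * \<eta>"
proof -
  obtain p where p: "polynomial_function p" "\<And>x. x \<in> {0..a} \<Longrightarrow> cmod (h x - p x) < \<eta>"
    using Stone_Weierstrass_polynomial_function[of "{0..a}" h \<eta>] h assms by auto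
  obtain p' where p': "polynomial_function p'" "\<And>x. (p has_vector_derivative p' x) (at x)"
    using has_vector_derivative_polynomial_function[OF p(1)] by blast
  define D where "D = (p a - p 0) / of_real a"
  define g where "g x = p x - p 0 - of_real x * D" for x
  show thesis
  proof (rule that)
    show "(g has_vector_derivative p' x - D) (at x)" for x
      unfolding g_def by (auto intro!: derivative_eq_intros p')
    show "continuous_on UNIV (\<lambda>x. p' x - D)"
      using p'(1) by (intro continuous_intros continuous_on_polymonial_function)
    show "g 0 = 0" "g a = 0" using \<open>0 < a\<close> by (auto simp: g_def D_def)
    fix x assume x: "x \<in> {0..a}"
    have p0: "cmod (p 0) < \<eta>" "cmod (p a) < \<eta>" using p(2)[of 0] p(2)[of a] h \<open>0 < a\<close> by auto
    have x1: "cmod (of_real (1 - x / a)) \<le> 1" "cmod (of_real (x / a)) \<le> 1"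
      using x \<open>0 < a\<close> by (simp_all only: norm_of_real) (auto simp: field_simps abs_le_iff)
    have "g x = p x - (of_real (1 - x / a) * p 0 + of_real (x / a) * p a)"
      using \<open>0 < a\<close> by (simp add: g_def D_def field_simps)
    then have "h x - g x = (h x - p x) + (of_real (1 - x / a) * p 0 + of_real (x / a) * p a)"
      by simp
    also have "cmod \<dots> \<le> cmod (h x - p x) + (cmod (of_real (1 - x / a) * p 0) + cmod (of_real (x / a) * p a))"
      by (intro norm_triangle_le add_mono norm_triangle_ineq order_refl)
    also have "\<dots> \<le> \<eta> + (1 * \<eta> + 1 * \<eta>)"
      unfolding norm_mult using p(2)[OF x] p0 x1
      by (intro add_mono mult_mono) (auto intro: less_imp_le simp del: of_real_diff of_real_divide)
    finally show "cmod (h x - g x) \<le> 3 * \<eta>" by simp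
  qed
qed

lemma L2_smooth_approximation:
  fixes \<phi> :: "real \<Rightarrow> complex"
  assumes \<phi>: "\<phi> \<in> L2" and "0 < a" "0 < \<delta>"
  obtains g g' where "\<And>x. (g has_vector_derivative g' x) (at x)" "continuous_on UNIV g'"
    and "g 0 = 0" "g a = 0" "(L2_norm (\<lambda>x. (\<phi> x - g x) * indicator {0..a} x))\<^sup>2 < \<delta>"
proof -
  \<comment> \<open>Three errors: truncation, continuous approximation, polynomial approximation.
    Two uses of \<open>L2_norm_add_le\<close> weight them by 2, 4 and 4, so the budgets \<delta>/8,
    \<delta>/16 and \<delta>/16 add up to 3 \<delta>/4.\<close>
  obtain m :: nat where "0 < m"
    and c: "(\<lambda>x. closest_point (cball 0 (real m)) (\<phi> x)) \<in> L2"
    and c1: "(L2_norm (\<lambda>x. \<phi> x - closest_point (cball 0 (real m)) (\<phi> x)))\<^sup>2 < \<delta> / 8"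
    by (rule L2_truncation[OF \<phi>, of "\<delta> / 8"]) (use \<open>0 < \<delta>\<close> in auto)
  define f where "f x = closest_point (cball 0 (real m)) (\<phi> x)" for x
  have f: "f \<in> L2" "cmod (f x) \<le> m" for x
    using c closest_point_in_set[of "cball (0::complex) (real m)" "\<phi> x"]
    by (auto simp: f_def[abs_def])
  have ind: "(L2_norm (\<lambda>x. (\<phi> x - f x) * indicator {0..a} x))\<^sup>2 \<le> (L2_norm (\<lambda>x. \<phi> x - f x))\<^sup>2"
    unfolding L2_norm_square
    by (intro integral_mono L2_integrable_norm L2_restrict L2_diff \<phi> f) (auto simp: indicator_def)
  with c1 have 1: "(L2_norm (\<lambda>x. (\<phi> x - f x) * indicator {0..a} x))\<^sup>2 < \<delta> / 8"
    by (simp add: f_def)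
  obtain h where h: "continuous_on {0..a} h" "h 0 = 0" "h a = 0"
    and 2: "(L2_norm (\<lambda>x. (f x - h x) * indicator {0..a} x))\<^sup>2 < \<delta> / 16"
    by (rule L2_continuous_approximation[OF f \<open>0 < a\<close>, of "\<delta> / 16"]) (use \<open>0 < \<delta>\<close> in auto)
  \<comment> \<open>Solves (3 \<eta>)^2 a = \<delta>/16.\<close>
  define \<eta> where "\<eta> = sqrt (\<delta> / (144 * a))"
  have \<eta>: "0 < \<eta>" "\<eta>\<^sup>2 = \<delta> / (144 * a)" using \<open>0 < a\<close> \<open>0 < \<delta>\<close> by (auto simp: \<eta>_def)
  obtain g g' where g: "\<And>x. (g has_vector_derivative g' x) (at x)" "continuous_on UNIV g'"
    "g 0 = 0" "g a = 0" and hg: "\<And>x. x \<in> {0..a} \<Longrightarrow> cmod (h x - g x) \<le> 3 * \<eta>"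
    by (rule polynomial_approximation_vanishing[OF h \<open>0 < a\<close> \<eta>(1)]) (rule that)
  have g_cont: "continuous_on X g" for X
    using g(1) by (meson continuous_at_imp_continuous_on has_vector_derivative_continuous)
  have hL2: "(\<lambda>x. h x * indicator {0..a} x) \<in> L2" by (rule L2_continuous_on[OF h(1)])
  have gL2: "(\<lambda>x. g x * indicator {0..a} x) \<in> L2" by (rule L2_continuous_on[OF g_cont])
  have fL2: "(\<lambda>x. f x * indicator {0..a} x) \<in> L2" by (rule L2_restrict[OF f(1)])
  have \<phi>L2: "(\<lambda>x. \<phi> x * indicator {0..a} x) \<in> L2" by (rule L2_restrict[OF \<phi>])
  have d1: "(\<lambda>x. (\<phi> x - f x) * indicator {0..a} x) \<in> L2"
    using L2_diff[OF \<phi>L2 fL2] by (simp add: left_diff_distrib)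
  have d2: "(\<lambda>x. (f x - h x) * indicator {0..a} x) \<in> L2"
    using L2_diff[OF fL2 hL2] by (simp add: left_diff_distrib)
  have d3: "(\<lambda>x. (h x - g x) * indicator {0..a} x) \<in> L2"
    using L2_diff[OF hL2 gL2] by (simp add: left_diff_distrib)
  have "(L2_norm (\<lambda>x. (h x - g x) * indicator {0..a} x))\<^sup>2 \<le> (3 * \<eta>)\<^sup>2 * (a - 0)"
    using hg \<open>0 < a\<close> \<eta> by (intro L2_norm_le_on_interval d3) auto
  also have "\<dots> = \<delta> / 16" using \<open>0 < a\<close> \<eta> by (simp add: power_mult_distrib)
  finally have 3: "(L2_norm (\<lambda>x. (h x - g x) * indicator {0..a} x))\<^sup>2 \<le> \<delta> / 16" .
  have "(\<lambda>x. (\<phi> x - g x) * indicator {0..a} x) =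
      (\<lambda>x. (\<phi> x - f x) * indicator {0..a} x + ((f x - h x) * indicator {0..a} x + (h x - g x) * indicator {0..a} x))"
    by (simp add: fun_eq_iff algebra_simps)
  then have "(L2_norm (\<lambda>x. (\<phi> x - g x) * indicator {0..a} x))\<^sup>2
      \<le> 2 * (L2_norm (\<lambda>x. (\<phi> x - f x) * indicator {0..a} x))\<^sup>2
        + 2 * (L2_norm (\<lambda>x. (f x - h x) * indicator {0..a} x + (h x - g x) * indicator {0..a} x))\<^sup>2"
    by (simp only:) (intro L2_norm_add_le L2_add d1 d2 d3)
  moreover have "(L2_norm (\<lambda>x. (f x - h x) * indicator {0..a} x + (h x - g x) * indicator {0..a} x))\<^sup>2
      \<le> 2 * (L2_norm (\<lambda>x. (f x - h x) * indicator {0..a} x))\<^sup>2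
        + 2 * (L2_norm (\<lambda>x. (h x - g x) * indicator {0..a} x))\<^sup>2"
    by (intro L2_norm_add_le d2 d3)
  ultimately have "(L2_norm (\<lambda>x. (\<phi> x - g x) * indicator {0..a} x))\<^sup>2 < \<delta>"
    using 1 2 3 \<open>0 < \<delta>\<close> by linarith
  with g show thesis by (rule that)
qed

subsection \<open>Approximation from the sampling spaces\<close>

context sampling
begin

text \<open>Integration by parts over the support of one translate: g vanishes at 0 and a, so no
  boundary term remains, and the support lies in the sampling interval, so the cutoff of the
  sampling function is not felt.\<close>

lemma inner_derivative:
  assumes g: "\<And>x. (g has_vector_derivative g' x) (at x)" "continuous_on UNIV g'" "g 0 = 0" "g a = 0"
    and "0 \<le> a" "0 < b" and k: "lo \<le> of_int k / b" "(of_int k + a) / b \<le> hi"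
  shows "freq l * L2_inner (\<lambda>x. g (b * x - of_int k) * indicator {0..a} (b * x - of_int k)) (s l)
    = of_real b * L2_inner (\<lambda>x. g' (b * x - of_int k) * indicator {0..a} (b * x - of_int k)) (s l)"
proof -
  define p where "p = of_int k / b"
  define q where "q = (of_int k + a) / b"
  have pq: "p \<le> q" "lo \<le> p" "q \<le> hi" "b * p - of_int k = 0" "b * q - of_int k = a"
    using assms by (auto simp: p_def q_def divide_right_mono)
  have ind: "indicator {0..a} (b * x - of_int k) = (indicator {p..q} x :: complex)" for x
    using \<open>0 < b\<close> by (auto simp: p_def q_def indicator_def field_simps)
  have sub: "indicator {p..q} x * indicator {lo..hi} x = (indicator {p..q} x :: complex)" for x
    using pq by (auto simp: indicator_def)
  have g_cont: "continuous_on X g" for X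
    using g(1) by (meson continuous_at_imp_continuous_on has_vector_derivative_continuous)
  have gc: "continuous_on X (\<lambda>x. g (b * x - of_int k))" for X
    by (rule continuous_on_compose2[OF g_cont[of UNIV]]) (auto intro!: continuous_intros)
  have g'c: "continuous_on X (\<lambda>x. g' (b * x - of_int k))" for X
    by (rule continuous_on_compose2[OF g(2)]) (auto intro!: continuous_intros)
  have comp: "((\<lambda>x. g (b * x - of_int k)) has_vector_derivative of_real b * g' (b * x - of_int k)) (at x within X)"
    for x X
  proof -
    have "((\<lambda>x. b * x - of_int k) has_vector_derivative b) (at x)"
      by (auto intro!: derivative_eq_intros)
    from vector_diff_chain_at[OF this g(1)] show ?thesis
      by (simp add: o_def scaleR_conv_of_real has_vector_derivative_at_within)
  qed
  \<comment> \<open>Chosen so that \<open>e x * wave (- l) x\<close> is the derivative of the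
    product of \<open>g (b * x - of_int k)\<close> and \<open>wave (- l) x\<close>.\<close>
  define e where "e x = of_real b * g' (b * x - of_int k) - freq l * g (b * x - of_int k)" for x
  have "has_bochner_integral lebesgue (\<lambda>x. (e x * wave (- l) x) * indicator {p..q} x)
      (g (b * q - of_int k) * wave (- l) q - g (b * p - of_int k) * wave (- l) p)"
  proof (rule has_bochner_integral_lebesgue_FTC)
    fix x
    have "((\<lambda>x. g (b * x - of_int k) * wave (- l) x) has_vector_derivative
        g (b * x - of_int k) * (freq (- l) * wave (- l) x) + of_real b * g' (b * x - of_int k) * wave (- l) x)
        (at x within {p..q})"
      by (intro has_vector_derivative_mult comp wave_derivative)
    moreover have "freq (- l) = - freq l" by (simp add: freq_def)
    ultimately show "((\<lambda>x. g (b * x - of_int k) * wave (- l) x) has_vector_derivative e x * wave (- l) x)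
        (at x within {p..q})"
      by (simp add: e_def algebra_simps)
  qed (use pq in \<open>auto simp: e_def intro!: continuous_intros gc g'c continuous_wave\<close>)
  then have 0: "(LINT x|lebesgue. (e x * wave (- l) x) * indicator {p..q} x) = 0"
    using g pq by (simp add: has_bochner_integral_iff)
  define G where "G x = g (b * x - of_int k) * indicator {0..a} (b * x - of_int k)" for x
  define G' where "G' x = g' (b * x - of_int k) * indicator {0..a} (b * x - of_int k)" for x
  have L2: "G \<in> L2" "G' \<in> L2"
    unfolding G_def[abs_def] G'_def[abs_def] ind by (intro L2_continuous_on gc g'c)+
  have "L2_inner (\<lambda>x. of_real b * G' x - freq l * G x) (s l)
      = (LINT x|lebesgue. of_real (sqrt \<epsilon>) * ((e x * wave (- l) x) * indicator {p..q} x))"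
  proof -
    have "(of_real b * G' x - freq l * G x) * cnj (s l x)
        = of_real (sqrt \<epsilon>) * ((e x * wave (- l) x) * (indicator {p..q} x * indicator {lo..hi} x))" for x
    proof -
      have "cnj (indicator {lo..hi} x) = (indicator {lo..hi} x :: complex)"
        by (simp add: indicator_def)
      then show ?thesis
        unfolding G_def G'_def ind e_def by (simp add: s_eq cnj_wave algebra_simps)
    qed
    then show ?thesis by (simp add: L2_inner_def sub)
  qed
  also have "\<dots> = 0" using 0 by simp
  finally have "of_real b * L2_inner G' (s l) - freq l * L2_inner G (s l) = 0"
    by (subst (asm) L2_inner_diff_left) (auto simp: L2 L2_scale s_L2 L2_inner_scale_left)
  then show ?thesis by (simp add: G_def[abs_def] G'_def[abs_def])
qed

lemma norm_freq: "cmod (freq l) = 2 * pi * \<bar>of_int l\<bar> * \<epsilon>"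
  using eps by (simp add: freq_def norm_mult)

text \<open>The constant is fixed before b, M, K and \<alpha>, which gives uniformity over all
  scales. The energy bound b is what a unit vector at scale b = 2^R has.\<close>

lemma sampling_space_approximation:
  fixes \<phi> :: "real \<Rightarrow> complex"
  assumes \<phi>: "\<phi> \<in> L2" "\<And>x. x \<notin> {0..a} \<Longrightarrow> \<phi> x = 0" and a: "0 < a" and \<delta>: "0 < \<delta>"
  shows "\<exists>C>0. \<forall>b M K \<alpha>. 0 < b \<and> C * b / \<epsilon> \<le> real M \<and> finite K
      \<and> (\<forall>k\<in>K. lo \<le> of_int k / b \<and> (of_int k + a) / b \<le> hi) \<and> (\<Sum>k\<in>K. (cmod (\<alpha> k))\<^sup>2) \<le> b
    \<longrightarrow> (\<exists>t \<in> sampling_space T1 T2 \<epsilon> M.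
          (L2_norm (\<lambda>x. (\<Sum>k\<in>K. \<alpha> k * \<phi> (b * x - of_int k)) - t x))\<^sup>2 \<le> \<delta>)"
proof -
  \<comment> \<open>\<open>norm_sum_translates\<close> with energy at most b multiplies the error by
    a + 1, which leaves \<delta>/4; together with \<delta>/4 for the Fourier tail, each doubled,
    this makes \<delta>.\<close>
  define \<delta>1 where "\<delta>1 = \<delta> / (4 * (a + 1))"
  have \<delta>1: "0 < \<delta>1" using a \<delta> by (simp add: \<delta>1_def)
  obtain g g' where g: "\<And>x. (g has_vector_derivative g' x) (at x)" "continuous_on UNIV g'"
    "g 0 = 0" "g a = 0" and \<phi>g: "(L2_norm (\<lambda>x. (\<phi> x - g x) * indicator {0..a} x))\<^sup>2 < \<delta>1"
    by (rule L2_smooth_approximation[OF \<phi>(1) a \<delta>1]) (rule that)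
  have g_cont: "continuous_on X g" for X
    using g(1) by (meson continuous_at_imp_continuous_on has_vector_derivative_continuous)
  define G where "G x = g x * indicator {0..a} x" for x
  define G' where "G' x = g' x * indicator {0..a} x" for x
  have GL2: "G \<in> L2" unfolding G_def[abs_def] by (rule L2_continuous_on[OF g_cont])
  have G'L2: "G' \<in> L2"
    unfolding G'_def[abs_def] by (rule L2_continuous_on) (rule continuous_on_subset[OF g(2)], simp)
  \<comment> \<open>Since g 0 = g a = 0, cutting off agrees with clamping the argument to [0, a],
    which is visibly continuous.\<close>
  have G_eq: "G = (\<lambda>x. g (max 0 (min a x)))"
    using g a by (auto simp: G_def fun_eq_iff indicator_def max_def min_def)
  have G_cont: "continuous_on X G" for X
    unfolding G_eq by (rule continuous_on_compose2[OF g_cont[of UNIV]]) (auto intro!: continuous_intros)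
  have G_zero: "G x = 0" if "x \<le> 0 \<or> a \<le> x" for x
    using that g a by (auto simp: G_def indicator_def)
  define N where "N = (L2_norm G')\<^sup>2"
  \<comment> \<open>The tail is at most \<kappa>^2 (a + 1) N with \<kappa> <= 1/C. The summand 1
    gives C >= 1, hence \<kappa> <= 1; then 4 \<kappa>^2 (a + 1) N <= \<kappa>^2 C \<delta> <=
    \<kappa> \<delta> <= \<delta>.\<close>
  define C where "C = 1 + 4 * (a + 1) * N / \<delta>"
  have C1: "1 \<le> C" using a \<delta> by (simp add: C_def N_def)
  have CN: "4 * (a + 1) * N \<le> C * \<delta>" using \<delta> by (simp add: C_def field_simps)
  show ?thesis
  proof (intro exI[of _ C] conjI allI impI)
    show "0 < C" using C1 by simp
    fix b :: real and M :: nat and K :: "int set" and \<alpha> :: "int \<Rightarrow> complex"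
    assume "0 < b \<and> C * b / \<epsilon> \<le> real M \<and> finite K
      \<and> (\<forall>k\<in>K. lo \<le> of_int k / b \<and> (of_int k + a) / b \<le> hi) \<and> (\<Sum>k\<in>K. (cmod (\<alpha> k))\<^sup>2) \<le> b"
    then have b: "0 < b" and M: "C * b / \<epsilon> \<le> real M" and K: "finite K"
      and supp: "\<And>k. k \<in> K \<Longrightarrow> lo \<le> of_int k / b \<and> (of_int k + a) / b \<le> hi"
      and \<alpha>: "(\<Sum>k\<in>K. (cmod (\<alpha> k))\<^sup>2) \<le> b"
      by auto
    define A where "A = {- \<lfloor>real M / 2\<rfloor>..\<lceil>real M / 2\<rceil> - 1}"
    have "0 < C * b / \<epsilon>" using C1 b eps by simp
    with M have M0: "0 < real M" by linarith
    \<comment> \<open>The dilation factor b of the derivative divided by \<pi> M \<epsilon>, a lower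
      bound for the modulus of every omitted frequency.\<close>
    define \<kappa> where "\<kappa> = b / (pi * real M * \<epsilon>)"
    have \<kappa>: "0 < \<kappa>" using b M0 eps by (simp add: \<kappa>_def)
    have \<kappa>C: "\<kappa> * C \<le> 1"
    proof -
      have "C * b \<le> real M * \<epsilon>" using M eps by (simp add: field_simps)
      also have "\<dots> \<le> pi * (real M * \<epsilon>)"
        using M0 eps pi_gt3 mult_right_mono[of 1 pi "real M * \<epsilon>"] by simp
      finally show ?thesis using M0 eps by (simp add: \<kappa>_def field_simps)
    qed
    define h where "h x = (\<Sum>k\<in>K. \<alpha> k * G (b * x - of_int k))" for x
    define d where "d x = (\<Sum>k\<in>K. \<alpha> k * G' (b * x - of_int k))" for x
    have out: "G (b * x - of_int k) = 0" if "k \<in> K" "x \<le> lo \<or> hi \<le> x" for x k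
    proof (rule G_zero)
      have "b * lo \<le> of_int k" "of_int k + a \<le> b * hi"
        using supp[OF that(1)] b by (auto simp: field_simps)
      moreover have "b * x \<le> b * lo \<or> b * hi \<le> b * x" using that(2) b by simp
      ultimately show "b * x - of_int k \<le> 0 \<or> a \<le> b * x - of_int k" by linarith
    qed
    have h_out: "h x = 0" if "x \<le> lo \<or> hi \<le> x" for x
      unfolding h_def using out that by (intro sum.neutral) auto
    have h_ind: "(\<lambda>x. h x * indicator {lo..hi} x) = h"
    proof
      fix x
      show "h x * indicator {lo..hi} x = h x"
        using h_out[of x] by (cases "x \<in> {lo..hi}") auto
    qed
    have h_cont: "continuous_on X h" for X
      unfolding h_def
      by (intro continuous_intros continuous_on_compose2[OF G_cont[of UNIV]]) auto
    have Gk: "(\<lambda>x. G (b * x - of_int k)) \<in> L2" "(\<lambda>x. G' (b * x - of_int k)) \<in> L2" for k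
      using L2_affine(1)[OF GL2, of b "- of_int k"] L2_affine(1)[OF G'L2, of b "- of_int k"] b by auto
    have hL2: "h \<in> L2" unfolding h_def[abs_def] by (intro L2_sum L2_scale Gk)
    have d: "d \<in> L2" "(L2_norm d)\<^sup>2 \<le> (a + 1) / b * (\<Sum>k\<in>K. (cmod (\<alpha> k))\<^sup>2) * N"
      using norm_sum_translates[of G' a b K \<alpha>] G'L2 a b K
      by (auto simp: d_def[abs_def] N_def G'_def)
    have d': "(L2_norm d)\<^sup>2 \<le> (a + 1) * N"
    proof -
      have "(a + 1) / b * (\<Sum>k\<in>K. (cmod (\<alpha> k))\<^sup>2) * N \<le> (a + 1) / b * b * N"
        using a b \<alpha> by (intro mult_right_mono mult_left_mono) (auto simp: N_def)
      with d b show ?thesis by simp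
    qed
    have deriv: "freq l * L2_inner h (s l) = of_real b * L2_inner d (s l)" for l
    proof -
      have "freq l * L2_inner h (s l) = (\<Sum>k\<in>K. \<alpha> k * (freq l * L2_inner (\<lambda>x. G (b * x - of_int k)) (s l)))"
        unfolding h_def[abs_def]
        by (subst L2_inner_linear_combination_left) (simp_all add: Gk s_L2 sum_distrib_left mult.left_commute)
      also have "\<dots> = (\<Sum>k\<in>K. \<alpha> k * (of_real b * L2_inner (\<lambda>x. G' (b * x - of_int k)) (s l)))"
        unfolding G_def G'_def using supp a b
        by (intro sum.cong arg_cong2[where f = "(*)"] inner_derivative g) auto
      also have "\<dots> = of_real b * L2_inner d (s l)"
        unfolding d_def[abs_def]
        by (subst L2_inner_linear_combination_left) (simp_all add: Gk s_L2 sum_distrib_left mult.left_commute)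
      finally show ?thesis .
    qed
    have decay: "cmod (L2_inner h (s l)) \<le> \<kappa> * cmod (L2_inner d (s l))" if "l \<notin> A" for l
    proof -
      \<comment> \<open>The index range is asymmetric for odd M, yet on either side the first
        omitted index has modulus at least M/2.\<close>
      have "real M / 2 \<le> \<bar>of_int l\<bar>" using that unfolding A_def by (simp add: not_le) linarith
      then have "pi * real M * \<epsilon> \<le> cmod (freq l)" using eps by (simp add: norm_freq field_simps)
      then have "pi * real M * \<epsilon> * cmod (L2_inner h (s l)) \<le> cmod (freq l) * cmod (L2_inner h (s l))"
        by (rule mult_right_mono) simp
      also have "\<dots> = b * cmod (L2_inner d (s l))"
        using arg_cong[OF deriv[of l], of cmod] b by (simp add: norm_mult)
      finally show ?thesis using M0 eps by (simp add: \<kappa>_def field_simps)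
    qed
    have "(L2_norm (\<lambda>x. h x - part A h x))\<^sup>2 \<le> \<kappa>\<^sup>2 * (L2_norm d)\<^sup>2"
    proof -
      have "h lo = h hi" using h_out by simp
      from residual_le[OF h_cont this, of A d \<kappa>] show ?thesis
        unfolding h_ind fun_cong[OF h_ind] using d decay by (auto simp: A_def)
    qed
    also have "\<dots> \<le> \<kappa>\<^sup>2 * ((a + 1) * N)" by (intro mult_left_mono d') simp
    also have "\<dots> \<le> \<delta> / 4"
    proof -
      have "4 * (\<kappa>\<^sup>2 * ((a + 1) * N)) = \<kappa>\<^sup>2 * (4 * (a + 1) * N)" by simp
      also have "\<dots> \<le> \<kappa>\<^sup>2 * (C * \<delta>)" by (intro mult_left_mono CN) simp
      also have "\<dots> = (\<kappa> * C) * (\<kappa> * \<delta>)" by (simp add: power2_eq_square)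
      also have "\<dots> \<le> 1 * (\<kappa> * \<delta>)" using \<kappa> \<delta> by (intro mult_right_mono \<kappa>C) simp
      also have "\<dots> \<le> 1 * \<delta>"
      proof -
        have "\<kappa> * 1 \<le> \<kappa> * C" using \<kappa> C1 by (intro mult_left_mono) auto
        then have "\<kappa> \<le> 1" using \<kappa>C by simp
        then show ?thesis using \<delta> by simp
      qed
      finally show ?thesis by simp
    qed
    finally have tail: "(L2_norm (\<lambda>x. h x - part A h x))\<^sup>2 \<le> \<delta> / 4" .
    define u where "u x = (\<phi> x - g x) * indicator {0..a} x" for x
    have u_eq: "u = (\<lambda>x. \<phi> x - G x)"
      using \<phi>(2) by (auto simp: u_def G_def fun_eq_iff indicator_def)
    have uL2: "u \<in> L2" unfolding u_eq by (intro L2_diff \<phi> GL2)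
    have sum_u: "(\<lambda>x. \<Sum>k\<in>K. \<alpha> k * u (b * x - of_int k)) \<in> L2"
      "(L2_norm (\<lambda>x. \<Sum>k\<in>K. \<alpha> k * u (b * x - of_int k)))\<^sup>2
        \<le> (a + 1) / b * (\<Sum>k\<in>K. (cmod (\<alpha> k))\<^sup>2) * (L2_norm u)\<^sup>2"
      using norm_sum_translates[of u a b K \<alpha>] uL2 a b K by (auto simp: u_def)
    have "(a + 1) / b * (\<Sum>k\<in>K. (cmod (\<alpha> k))\<^sup>2) * (L2_norm u)\<^sup>2 \<le> (a + 1) / b * b * \<delta>1"
      using a b \<alpha> \<phi>g unfolding u_def[abs_def]
      by (intro mult_mono) (auto intro!: sum_nonneg)
    also have "\<dots> = \<delta> / 4"
    proof -
      have "a + 1 \<noteq> 0" using a by simp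
      then show ?thesis using b unfolding \<delta>1_def by (simp add: divide_simps)
    qed
    finally have near: "(L2_norm (\<lambda>x. \<Sum>k\<in>K. \<alpha> k * u (b * x - of_int k)))\<^sup>2 \<le> \<delta> / 4"
      using sum_u by linarith
    have "(\<lambda>x. (\<Sum>k\<in>K. \<alpha> k * \<phi> (b * x - of_int k)) - part A h x)
        = (\<lambda>x. (\<Sum>k\<in>K. \<alpha> k * u (b * x - of_int k)) + (h x - part A h x))"
      by (simp add: fun_eq_iff u_eq h_def right_diff_distrib sum_subtractf)
    then have "(L2_norm (\<lambda>x. (\<Sum>k\<in>K. \<alpha> k * \<phi> (b * x - of_int k)) - part A h x))\<^sup>2
        \<le> 2 * (L2_norm (\<lambda>x. \<Sum>k\<in>K. \<alpha> k * u (b * x - of_int k)))\<^sup>2 + 2 * (L2_norm (\<lambda>x. h x - part A h x))\<^sup>2"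
      by (simp only:) (intro L2_norm_add_le sum_u L2_diff hL2 part_L2)
    also have "\<dots> \<le> \<delta>" using near tail by linarith
    finally have "(L2_norm (\<lambda>x. (\<Sum>k\<in>K. \<alpha> k * \<phi> (b * x - of_int k)) - part A h x))\<^sup>2 \<le> \<delta>" .
    moreover have "part A h \<in> sampling_space T1 T2 \<epsilon> M"
      unfolding sampling_space_def A_def part_def by (rule sum_in_span)
    ultimately show "\<exists>t \<in> sampling_space T1 T2 \<epsilon> M.
        (L2_norm (\<lambda>x. (\<Sum>k\<in>K. \<alpha> k * \<phi> (b * x - of_int k)) - t x))\<^sup>2 \<le> \<delta>" by blast
  qed
qed

end

subsection \<open>Essential support\<close>

text \<open>The defining union may be uncountable; Lindelof's theorem replaces it by a countable
  one, over which null sets may be united.\<close>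

lemma AE_ess_supp: "AE x in lebesgue. x \<notin> ess_supp f \<longrightarrow> f x = 0"
proof -
  define \<U> where "\<U> = {U. open U \<and> (AE x in lebesgue. x \<in> U \<longrightarrow> f x = 0)}"
  obtain \<V> where \<V>: "\<V> \<subseteq> \<U>" "countable \<V>" "\<Union>\<V> = \<Union>\<U>"
    by (rule Lindelof[of \<U>]) (auto simp: \<U>_def)
  then have "AE x in lebesgue. \<forall>U\<in>\<V>. x \<in> U \<longrightarrow> f x = 0"
    by (subst AE_ball_countable) (auto simp: \<U>_def)
  then show ?thesis
  proof eventually_elim
    case (elim x)
    then show ?case using \<V>(3) by (auto simp: ess_supp_def \<U>_def)
  qed
qed

lemma not_AE_zero_near_ess_supp:
  assumes "x \<in> ess_supp f" "open U" "x \<in> U"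
  shows "\<not> (AE y in lebesgue. y \<in> U \<longrightarrow> f y = 0)"
  using assms by (auto simp: ess_supp_def)

text \<open>The leftmost and the rightmost translate of a superposition are visible at the ends of its
  support, so all translates in it are supported in the support of the superposition.\<close>

lemma translates_supported:
  assumes supp: "ess_supp \<phi> = {0..a}" and a: "0 \<le> a" and K: "finite K" "\<And>k. k \<in> K \<Longrightarrow> \<alpha> k \<noteq> 0"
    and F: "AE x in lebesgue. F x = (\<Sum>k\<in>K. \<alpha> k * \<phi> (x - of_int k))"
    and zero: "AE x in lebesgue. x \<notin> {p..q} \<longrightarrow> F x = 0"
    and "k \<in> K"
  shows "p \<le> of_int k" and "of_int k + a \<le> q"
proof -
  have \<phi>: "AE x in lebesgue. x \<notin> {0..a} \<longrightarrow> \<phi> x = 0" using AE_ess_supp[of \<phi>] supp by simp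
  have "AE x in lebesgue. \<forall>k\<in>K. x - of_int k \<notin> {0..a} \<longrightarrow> \<phi> (x - of_int k) = 0"
  proof (subst AE_ball_countable)
    show "countable K" using K by (simp add: countable_finite)
    show "\<forall>k\<in>K. AE x in lebesgue. x - of_int k \<notin> {0..a} \<longrightarrow> \<phi> (x - of_int k) = 0"
    proof
      fix k
      show "AE x in lebesgue. x - of_int k \<notin> {0..a} \<longrightarrow> \<phi> (x - of_int k) = 0"
        using AE_affine[OF \<phi>, of 1 "- of_int k"] by simp
    qed
  qed
  with F zero have all: "AE x in lebesgue. (x \<notin> {p..q} \<longrightarrow> (\<Sum>k\<in>K. \<alpha> k * \<phi> (x - of_int k)) = 0) \<and>
      (\<forall>k\<in>K. x - of_int k \<notin> {0..a} \<longrightarrow> \<phi> (x - of_int k) = 0)"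
    by eventually_elim auto
  show "p \<le> of_int k"
  proof (rule ccontr)
    assume "\<not> p \<le> of_int k"
    define m where "m = Min K"
    have m: "m \<in> K" "\<And>j. j \<in> K \<Longrightarrow> m \<le> j"
      using K(1) \<open>k \<in> K\<close> by (auto simp: m_def intro: Min_in Min_le)
    have mp: "of_int m < p" using m(2)[OF \<open>k \<in> K\<close>] \<open>\<not> p \<le> of_int k\<close> by linarith
    \<comment> \<open>To the left of m + \<rho> the other translates have not begun, as integers
      differ by at least 1, and F vanishes, being left of p. So \<phi> would vanish near 0, against
      0 in its support.\<close>
    define \<rho> where "\<rho> = min 1 (p - of_int m)"
    have "AE x in lebesgue. x - of_int m < \<rho> \<longrightarrow> \<phi> (x - of_int m) = 0"
      using all
    proof eventually_elim
      case (elim x)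
      show ?case
      proof
        assume x: "x - of_int m < \<rho>"
        have "\<phi> (x - of_int j) = 0" if "j \<in> K - {m}" for j
        proof -
          have "m < j" using m(2)[of j] that by auto
          then have "of_int m + 1 \<le> (of_int j :: real)" by linarith
          then have "x - of_int j \<notin> {0..a}" using x by (auto simp: \<rho>_def)
          then show ?thesis using elim that by auto
        qed
        then have "(\<Sum>k\<in>K. \<alpha> k * \<phi> (x - of_int k)) = \<alpha> m * \<phi> (x - of_int m)"
          using K(1) m(1) by (subst sum.remove[of K m]) auto
        moreover have "x \<notin> {p..q}" using x by (auto simp: \<rho>_def)
        ultimately show "\<phi> (x - of_int m) = 0" using elim K(2)[OF m(1)] by auto
      qed
    qed
    from AE_affine[OF this, of 1 "of_int m"]
    have "AE y in lebesgue. y \<in> {..<\<rho>} \<longrightarrow> \<phi> y = 0" by simp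
    moreover have "0 \<in> ess_supp \<phi>" "0 \<in> {..<\<rho>}" using supp a mp by (auto simp: \<rho>_def)
    ultimately show False using not_AE_zero_near_ess_supp[of 0 \<phi> "{..<\<rho>}"] by auto
  qed
  show "of_int k + a \<le> q"
  proof (rule ccontr)
    assume "\<not> of_int k + a \<le> q"
    define m where "m = Max K"
    have m: "m \<in> K" "\<And>j. j \<in> K \<Longrightarrow> j \<le> m"
      using K(1) \<open>k \<in> K\<close> by (auto simp: m_def intro: Max_in Max_ge)
    have mq: "q < of_int m + a" using m(2)[OF \<open>k \<in> K\<close>] \<open>\<not> of_int k + a \<le> q\<close> by linarith
    \<comment> \<open>The mirror image: to the right of m + \<rho> all other translates have ended
      and q is passed, so \<phi> would vanish near a.\<close>
    define \<rho> where "\<rho> = max (a - 1) (q - of_int m)"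
    have "AE x in lebesgue. \<rho> < x - of_int m \<longrightarrow> \<phi> (x - of_int m) = 0"
      using all
    proof eventually_elim
      case (elim x)
      show ?case
      proof
        assume x: "\<rho> < x - of_int m"
        have "\<phi> (x - of_int j) = 0" if "j \<in> K - {m}" for j
        proof -
          have "j < m" using m(2)[of j] that by auto
          then have "of_int j + 1 \<le> (of_int m :: real)" by linarith
          then have "x - of_int j \<notin> {0..a}" using x by (auto simp: \<rho>_def)
          then show ?thesis using elim that by auto
        qed
        then have "(\<Sum>k\<in>K. \<alpha> k * \<phi> (x - of_int k)) = \<alpha> m * \<phi> (x - of_int m)"
          using K(1) m(1) by (subst sum.remove[of K m]) auto
        moreover have "x \<notin> {p..q}" using x by (auto simp: \<rho>_def)
        ultimately show "\<phi> (x - of_int m) = 0" using elim K(2)[OF m(1)] by auto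
      qed
    qed
    from AE_affine[OF this, of 1 "of_int m"]
    have "AE y in lebesgue. y \<in> {\<rho><..} \<longrightarrow> \<phi> y = 0" by simp
    moreover have "a \<in> ess_supp \<phi>" "a \<in> {\<rho><..}" using supp a mq by (auto simp: \<rho>_def)
    ultimately show False using not_AE_zero_near_ess_supp[of a \<phi> "{\<rho><..}"] by auto
  qed
qed

subsection \<open>Compactly supported elements of the multiresolution spaces\<close>

lemma L2_inner_zero_disjoint:
  assumes "AE x in lebesgue. f x = 0 \<or> g x = 0"
  shows "L2_inner f g = 0"
proof -
  have "AE x in lebesgue. f x * cnj (g x) = 0" using assms by eventually_elim auto
  then show ?thesis unfolding L2_inner_def by (rule integral_eq_zero_AE)
qed

text \<open>Only finitely many translates meet [p, q], so the expansion is a finite sum; what is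
  left over is orthogonal to every translate and therefore null. Discarding zero coefficients then
  allows \<open>translates_supported\<close> to confine each remaining translate.\<close>

lemma onb_compact_support_representation:
  assumes onb: "L2_onb (\<lambda>k x. \<phi> (x - of_int k)) W" and W: "L2_closed_subspace W"
    and supp: "ess_supp \<phi> = {0..a}" and a: "0 \<le> a"
    and F: "F \<in> W" and zero: "AE x in lebesgue. x \<notin> {p..q} \<longrightarrow> F x = 0"
  obtains K \<alpha> where "finite K" "AE x in lebesgue. F x = (\<Sum>k\<in>K. \<alpha> k * \<phi> (x - of_int k))"
    and "\<And>k. k \<in> K \<Longrightarrow> p \<le> of_int k \<and> of_int k + a \<le> q"
    and "(\<Sum>k\<in>K. (cmod (\<alpha> k))\<^sup>2) = (L2_norm F)\<^sup>2"
proof -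
  define e :: "int \<Rightarrow> real \<Rightarrow> complex" where "e k = (\<lambda>x. \<phi> (x - of_int k))" for k
  have onb': "range e \<subseteq> W" "\<And>k l. L2_inner (e k) (e l) = (if k = l then 1 else 0)"
    "L2_closure (cfun_span (range e)) = W"
    using onb unfolding L2_onb_def e_def[abs_def] by auto
  have WL2: "W \<subseteq> L2" and sub: "cfun_subspace W" using W by (auto simp: L2_closed_subspace_def)
  interpret L2_orthonormal e
    using onb' WL2 by unfold_locales auto
  have FL2: "F \<in> L2" using F WL2 by auto
  define \<alpha> where "\<alpha> k = L2_inner F (e k)" for k
  have \<phi>: "AE x in lebesgue. x \<notin> {0..a} \<longrightarrow> \<phi> x = 0" using AE_ess_supp[of \<phi>] supp by simp
  \<comment> \<open>The k for which [k, k + a] meets [p, q]; some of these translates may still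
    stick out of [p, q].\<close>
  define K0 where "K0 = {\<lceil>p - a\<rceil>..\<lfloor>q\<rfloor>}"
  have \<alpha>0: "\<alpha> k = 0" if "k \<notin> K0" for k
    unfolding \<alpha>_def
  proof (rule L2_inner_zero_disjoint)
    have "AE x in lebesgue. x - of_int k \<notin> {0..a} \<longrightarrow> e k x = 0"
      using AE_affine[OF \<phi>, of 1 "- of_int k"] by (simp add: e_def)
    with zero show "AE x in lebesgue. F x = 0 \<or> e k x = 0"
    proof eventually_elim
      case (elim x)
      have "of_int k < p - a \<or> q < of_int k" using that unfolding K0_def
        by (auto simp: ceiling_le_iff le_floor_iff not_le)
      then have "x \<notin> {p..q} \<or> x - of_int k \<notin> {0..a}" by auto
      with elim show ?case by auto
    qed
  qed
  define r where "r x = F x - part K0 F x" for x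
  have "finite K0" by (simp add: K0_def)
  have rW: "r \<in> W"
  proof -
    have "part K0 F \<in> cfun_span (e ` K0)" unfolding part_def by (rule sum_in_span)
    also have "cfun_span (e ` K0) \<subseteq> W" using onb'(1) sub by (intro cfun.span_minimal) auto
    finally show ?thesis using cfun.subspace_diff[OF sub F] by (simp add: r_def[abs_def] fun_diff_def)
  qed
  have rL2: "r \<in> L2" using rW WL2 by auto
  have r_e: "L2_inner r (e j) = 0" for j
  proof (cases "j \<in> K0")
    case True
    then show ?thesis unfolding r_def[abs_def] using \<open>finite K0\<close> FL2 by (intro inner_residual)
  next
    case False
    have "L2_inner (part K0 F) (e j) = 0"
      unfolding part_def using False \<open>finite K0\<close> by (subst inner_sum_left) auto
    then show ?thesis unfolding r_def[abs_def]
      using \<alpha>0[OF False] by (subst L2_inner_diff_left) (auto simp: FL2 part_L2 L2 \<alpha>_def)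
  qed
  have r_span: "s \<in> L2 \<and> L2_inner r s = 0" if "s \<in> cfun_span (range e)" for s
    using that
  proof (induction rule: cfun.span_induct_alt)
    case base
    show ?case using L2_zero by (simp add: zero_fun_def L2_inner_def)
  next
    case (step c w y)
    then obtain j where j: "w = e j" by auto
    have eq: "fscale c w + y = (\<lambda>x. c * e j x + y x)" by (simp add: fscale_def j fun_eq_iff)
    have "L2_inner (\<lambda>x. c * e j x + y x) r = 0"
      using step.IH r_e[of j] L2_inner_commute[of "e j" r] L2_inner_commute[of y r]
      by (subst L2_inner_add_left) (auto simp: L2 L2_scale rL2 L2_inner_scale_left)
    then show ?case
      unfolding eq using step.IH L2_inner_commute[of r "\<lambda>x. c * e j x + y x"]
      by (auto intro!: L2_add L2_scale L2)
  qed
  \<comment> \<open>r lies in the closure of the span and is orthogonal to the span, so approximants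
    t satisfy ||r|| <= ||r - t||.\<close>
  have "L2_norm r \<le> 0"
  proof (rule field_le_epsilon)
    fix \<delta> :: real assume "0 < \<delta>"
    then obtain t where t: "t \<in> cfun_span (range e)" "L2_norm (\<lambda>x. r x - t x) < \<delta>"
      using rW onb'(3) unfolding L2_closure_def by blast
    have "(L2_norm (\<lambda>x. r x - t x))\<^sup>2 = (L2_norm r)\<^sup>2 + (L2_norm t)\<^sup>2"
      using r_span[OF t(1)] rL2 by (intro L2_pythagoras_diff) auto
    then have "(L2_norm r)\<^sup>2 \<le> (L2_norm (\<lambda>x. r x - t x))\<^sup>2" by simp
    then have "L2_norm r \<le> L2_norm (\<lambda>x. r x - t x)" by (rule power2_le_imp_le) (rule L2_norm_nonneg)
    then show "L2_norm r \<le> 0 + \<delta>" using t(2) by simp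
  qed
  then have "AE x in lebesgue. r x = 0"
    using L2_norm_nonneg[of r] by (intro L2_norm_eq_0_imp_AE rL2) simp
  define K where "K = {k \<in> K0. \<alpha> k \<noteq> 0}"
  have K: "finite K" "\<And>k. k \<in> K \<Longrightarrow> \<alpha> k \<noteq> 0" using \<open>finite K0\<close> by (auto simp: K_def)
  have part_eq: "part K0 F x = (\<Sum>k\<in>K. \<alpha> k * e k x)" for x
    unfolding part_def using \<open>finite K0\<close>
    by (intro sum.mono_neutral_cong_right) (auto simp: K_def \<alpha>_def)
  have F_eq: "AE x in lebesgue. F x = (\<Sum>k\<in>K. \<alpha> k * e k x)"
    using \<open>AE x in lebesgue. r x = 0\<close> by eventually_elim (simp add: r_def part_eq)
  have "L2_norm F = L2_norm (\<lambda>x. \<Sum>k\<in>K. \<alpha> k * e k x)"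
    by (intro L2_norm_cong_AE FL2 sum_L2 F_eq)
  then have norm: "(\<Sum>k\<in>K. (cmod (\<alpha> k))\<^sup>2) = (L2_norm F)\<^sup>2" using norm_sum[OF K(1)] by simp
  show thesis
  proof (rule that[OF K(1) _ _ norm])
    show "AE x in lebesgue. F x = (\<Sum>k\<in>K. \<alpha> k * \<phi> (x - of_int k))" using F_eq by (simp add: e_def)
    then show "p \<le> of_int k \<and> of_int k + a \<le> q" if "k \<in> K" for k
      using translates_supported[where \<alpha> = \<alpha> and k = k, OF supp a K(1) K(2) _ zero that] by simp
  qed
qed

section \<open>Dilations in the multiresolution analysis and the position of the reconstruction
  spaces in it\<close>

lemma mra_mono:
  assumes "mra V \<phi>" "i \<le> j"
  shows "V i \<subseteq> V j"
  using assms(2)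
proof (induction rule: int_ge_induct)
  case (step j)
  with assms(1) show ?case by (auto simp: mra_def)
qed simp

lemma mra_dilation:
  assumes "mra V \<phi>"
  shows "(\<lambda>x. f (2 * x)) \<in> V (j + 1) \<longleftrightarrow> f \<in> V j"
proof -
  have "\<forall>j f. f \<in> V j \<longleftrightarrow> (\<lambda>x. f (2 * x)) \<in> V (j + 1)"
    using assms unfolding mra_def by (elim conjE)
  then show ?thesis by simp
qed

lemma mra_dilate:
  assumes "mra V \<phi>" "f \<in> V i"
  shows "(\<lambda>x. f (2 ^ j * x)) \<in> V (i + int j)"
proof (induction j)
  case (Suc j)
  then have "(\<lambda>x. f (2 ^ j * (2 * x))) \<in> V (i + int j + 1)"
    using mra_dilation[OF assms(1), of "\<lambda>x. f (2 ^ j * x)" "i + int j"] by simp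
  moreover have "2 ^ j * (2 * x) = 2 ^ Suc j * x" for x :: real by simp
  moreover have "i + int j + 1 = i + int (Suc j)" by simp
  ultimately show ?case by (simp only:)
qed (use assms in simp)

lemma mra_contract:
  assumes "mra V \<phi>" "f \<in> V (int j)"
  shows "(\<lambda>x. f (x / 2 ^ j)) \<in> V 0"
  using assms(2)
proof (induction j arbitrary: f)
  case (Suc j)
  have "(\<lambda>x. f (x / 2)) \<in> V (int j)"
    using mra_dilation[OF assms(1), of "\<lambda>x. f (x / 2)" "int j"] Suc.prems
    by (simp add: add.commute)
  from Suc.IH[OF this] show ?case by (simp add: mult.commute)
qed simp

text \<open>Both conditions are linear, so generators suffice. The bound on N admits only wavelets
  of scale j < R, and those lie in V_(j+1), hence in V_R.\<close>

lemma recon_space_subset: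
  assumes mra: "mra V \<phi>" and wav: "assoc_wavelet V \<psi>" and a: "1 \<le> a"
    and supp: "ess_supp \<phi> = {0..a}" "ess_supp \<psi> = {0..a}"
    and T: "T1 \<ge> of_int \<lceil>a\<rceil> - 1" "T2 \<ge> 2 * of_int \<lceil>a\<rceil> - 1" and N: "N \<le> recon_dim a R"
  shows "recon_space \<phi> \<psi> a N \<subseteq> {f \<in> V (int R). AE x in lebesgue. x \<notin> {- T1..T2} \<longrightarrow> f x = 0}"
    (is "_ \<subseteq> ?X")
  unfolding recon_space_def
proof (rule cfun.span_minimal)
  have sub: "cfun_subspace (V j)" for j using mra by (auto simp: mra_def L2_closed_subspace_def)
  show "cfun_subspace ?X"
  proof (rule cfun.subspaceI)
    show "0 \<in> ?X" using cfun.subspace_0[OF sub] by auto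
    show "f + g \<in> ?X" if "f \<in> ?X" "g \<in> ?X" for f g
    proof -
      have "AE x in lebesgue. x \<notin> {- T1..T2} \<longrightarrow> f x = 0" "AE x in lebesgue. x \<notin> {- T1..T2} \<longrightarrow> g x = 0"
        using that by auto
      then have "AE x in lebesgue. x \<notin> {- T1..T2} \<longrightarrow> (f + g) x = 0" by eventually_elim auto
      then show ?thesis using that cfun.subspace_add[OF sub] by auto
    qed
    show "fscale c f \<in> ?X" if "f \<in> ?X" for c f
      using that cfun.subspace_scale[OF sub] by (auto simp: fscale_def)
  qed
  \<comment> \<open>Covers the \<phi>-terms too, as j = 0. The support runs from k/2^j >=
    -(\<lceil>a\<rceil> - 1) to (k + a)/2^j <= 2 \<lceil>a\<rceil> - 1; these bounds for T1 and T2
    are dictated by j = 0.\<close>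
  have dil: "AE x in lebesgue. x \<notin> {- T1..T2} \<longrightarrow> dilate g j k x = 0"
    if g: "ess_supp g = {0..a}" and k: "- \<lceil>a\<rceil> + 1 \<le> k" "k \<le> 2 ^ j * \<lceil>a\<rceil> - 1" for g j k
  proof -
    have "AE x in lebesgue. x \<notin> {0..a} \<longrightarrow> g x = 0" using AE_ess_supp[of g] g by simp
    from AE_affine[OF this, of "2 ^ j" "- of_int k"]
    have "AE x in lebesgue. 2 ^ j * x - of_int k \<notin> {0..a} \<longrightarrow> g (2 ^ j * x - of_int k) = 0" by simp
    then show ?thesis
    proof eventually_elim
      case (elim x)
      show ?case
      proof
        assume x: "x \<notin> {- T1..T2}"
        have j1: "(1::real) \<le> 2 ^ j" by simp
        have ca: "a \<le> of_int \<lceil>a\<rceil>" "1 \<le> (of_int \<lceil>a\<rceil> :: real)" using a by linarith+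
        have "2 ^ j * x - of_int k \<notin> {0..a}"
        proof (cases "x < - T1")
          case True
          then have "x < - (of_int \<lceil>a\<rceil> - 1)" using T by linarith
          then have "2 ^ j * x < 2 ^ j * (- (of_int \<lceil>a\<rceil> - 1))" by simp
          also have "\<dots> \<le> 1 * (- (of_int \<lceil>a\<rceil> - 1))" using j1 ca by (intro mult_right_mono_neg) auto
          also have "\<dots> \<le> of_int k"
          proof -
            have "real_of_int (- \<lceil>a\<rceil> + 1) \<le> real_of_int k" using k(1) by (simp only: of_int_le_iff)
            then show ?thesis by simp
          qed
          finally show ?thesis by auto
        next
          case False
          then have "2 * of_int \<lceil>a\<rceil> - 1 < x" using x T by auto
          then have "2 ^ j * (2 * of_int \<lceil>a\<rceil> - 1) < 2 ^ j * x" by simp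
          moreover have "real_of_int k \<le> real_of_int (2 ^ j * \<lceil>a\<rceil> - 1)" using k(2) by (simp only: of_int_le_iff)
          moreover have "1 * (of_int \<lceil>a\<rceil> - 1) \<le> (2 ^ j * (of_int \<lceil>a\<rceil> - 1) :: real)"
            using j1 ca by (intro mult_right_mono) auto
          ultimately have "a < 2 ^ j * x - of_int k" using ca(1)
            by (simp add: algebra_simps del: le_of_int_ceiling)
          then show ?thesis by auto
        qed
        with elim show "dilate g j k x = 0" by (simp add: dilate_def)
      qed
    qed
  qed
  show "Omega_enum \<phi> \<psi> a ` {1..N} \<subseteq> ?X"
  proof
    fix f assume "f \<in> Omega_enum \<phi> \<psi> a ` {1..N}"
    then obtain n where n: "1 \<le> n" "n \<le> N" "f = Omega_enum \<phi> \<psi> a n" by auto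
    then have "f = Omega_list \<phi> \<psi> a R ! (n - 1)" using Omega_enum_eq[of a n R] a N by simp
    then have "f \<in> set (Omega_list \<phi> \<psi> a R)"
      using n N length_Omega_list[OF a, of \<phi> \<psi> R] by (auto intro!: nth_mem)
    then consider k where "f = dilate \<phi> 0 k" "- (\<lceil>a\<rceil> - 1) \<le> k" "k \<le> \<lceil>a\<rceil> - 1"
      | j k where "j < R" "f = dilate \<psi> j k" "- \<lceil>a\<rceil> + 1 \<le> k" "k \<le> 2 ^ j * \<lceil>a\<rceil> - 1"
      unfolding Omega_list_def by auto
    then show "f \<in> ?X"
    proof cases
      case 1
      have "(\<lambda>x. \<phi> (x - of_int k)) \<in> V 0" using mra unfolding mra_def L2_onb_def by blast
      then have "f \<in> V 0" by (simp add: 1 dilate_def)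
      then have "f \<in> V (int R)" using mra_mono[OF mra, of 0 "int R"] by auto
      then show ?thesis using dil[OF supp(1), of k 0] 1 by simp
    next
      case 2
      have "(\<lambda>x. \<psi> (x - of_int k)) \<in> V 1" using wav unfolding assoc_wavelet_def L2_onb_def by blast
      from mra_dilate[OF mra this, of j]
      have "fscale (of_real (2 powr (real j / 2))) (\<lambda>x. \<psi> (2 ^ j * x - of_int k)) \<in> V (1 + int j)"
        by (rule cfun.subspace_scale[OF sub])
      then have "f \<in> V (1 + int j)" by (simp add: 2 dilate_def fscale_def)
      then have "f \<in> V (int R)" using mra_mono[OF mra, of "1 + int j" "int R"] 2(1) by auto
      then show ?thesis using dil[OF supp(2), of k j] 2 by simp
    qed
  qed
qed

text \<open>Makes the set under the infimum nonempty, without which a lower bound for its elements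
  says nothing about \<open>Inf\<close>.\<close>

lemma recon_space_unit_vector:
  assumes mra: "mra V \<phi>" and a: "1 \<le> a" and N: "1 \<le> N"
  obtains f where "f \<in> recon_space \<phi> \<psi> a N" "L2_norm f = 1"
proof -
  have c: "1 \<le> \<lceil>a\<rceil>" using a by linarith
  have len: "recon_dim a 0 \<ge> 1" using c by (simp add: recon_dim_def) linarith
  have "Omega_enum \<phi> \<psi> a 1 = Omega_list \<phi> \<psi> a 0 ! 0"
    using Omega_enum_eq[of a 1 0] a len by simp
  also have "\<dots> \<in> set (Omega_list \<phi> \<psi> a 0)"
    using len length_Omega_list[OF a, of \<phi> \<psi> 0] by (intro nth_mem) simp
  finally obtain k where k: "Omega_enum \<phi> \<psi> a 1 = dilate \<phi> 0 k" by (auto simp: Omega_list_def)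
  have "L2_inner (\<lambda>x. \<phi> (x - of_int k)) (\<lambda>x. \<phi> (x - of_int k)) = 1"
    using mra unfolding mra_def L2_onb_def by auto
  then have "complex_of_real ((L2_norm (dilate \<phi> 0 k))\<^sup>2) = of_real 1"
    unfolding L2_inner_self by (simp add: dilate_def)
  then have "(L2_norm (dilate \<phi> 0 k))\<^sup>2 = 1" unfolding of_real_eq_iff .
  then have "L2_norm (dilate \<phi> 0 k) = 1" using L2_norm_nonneg[of "dilate \<phi> 0 k"] by (simp add: power2_eq_1_iff)
  moreover have "Omega_enum \<phi> \<psi> a 1 \<in> recon_space \<phi> \<psi> a N"
    unfolding recon_space_def using N by (intro cfun.span_base imageI) auto
  ultimately show thesis using that k by simp
qed

subsection \<open>The stable sampling rate\<close>

lemma subspace_cos_ge: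
  assumes mra: "mra V \<phi>" and wav: "assoc_wavelet V \<psi>" and a: "1 \<le> a"
    and supp: "ess_supp \<phi> = {0..a}" "ess_supp \<psi> = {0..a}"
    and T12: "T1 \<ge> of_int \<lceil>a\<rceil> - 1" "T2 \<ge> 2 * of_int \<lceil>a\<rceil> - 1"
    and \<epsilon>: "0 < \<epsilon>" "\<epsilon> \<le> 1 / (T1 + T2)" and c: "0 \<le> c" "c < 1"
  obtains C where "0 < C"
    and "\<And>R N M. \<lbrakk>1 \<le> N; N \<le> recon_dim a R; C * 2 ^ R / \<epsilon> \<le> real M\<rbrakk>
      \<Longrightarrow> c \<le> subspace_cos \<phi> \<psi> a T1 T2 \<epsilon> N M"
proof -
  have "1 \<le> (of_int \<lceil>a\<rceil> :: real)" using a by linarith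
  then have T0: "0 \<le> T1" "0 < T2" "0 < T1 + T2" using T12 by linarith+
  interpret sampling T1 T2 \<epsilon> using T0 \<epsilon> by unfold_locales
  have eT: "\<epsilon> * (T1 + T2) \<le> 1" "0 < \<epsilon> * (T1 + T2)"
    using \<epsilon> T0 mult_pos_pos[OF \<epsilon>(1) T0(3)] by (auto simp: pos_le_divide_eq)
  \<comment> \<open>The density condition \<epsilon> (T1 + T2) <= 1 is what makes the sampling
    interval contain [-T1, T2].\<close>
  have lo: "lo \<le> - T1"
  proof -
    have "T1 * (\<epsilon> * (T1 + T2)) \<le> T1 * 1" using eT T0 by (intro mult_left_mono) auto
    then show ?thesis using eT by (simp add: lo_def pos_le_divide_eq)
  qed
  have hi: "T2 \<le> hi"
  proof -
    have "T2 * (\<epsilon> * (T1 + T2)) \<le> T2 * 1" using eT T0 by (intro mult_left_mono) auto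
    then show ?thesis using eT by (simp add: hi_def pos_le_divide_eq)
  qed
  have V0: "L2_closed_subspace (V 0)" "L2_onb (\<lambda>k x. \<phi> (x - of_int k)) (V 0)" "\<And>j. V j \<subseteq> L2"
    using mra by (auto simp: mra_def L2_closed_subspace_def)
  have \<phi>L2: "\<phi> \<in> L2"
  proof -
    have "(\<lambda>x. \<phi> (x - of_int 0)) \<in> V 0" using V0(2) unfolding L2_onb_def by blast
    then show ?thesis using V0(3) by auto
  qed
  have a0: "0 < a" "0 \<le> a" using a by auto
  \<comment> \<open>\<phi> vanishes outside [0, a] only almost everywhere; the overlap count needs a
    representative that does so at every point.\<close>
  define \<phi>0 where "\<phi>0 x = \<phi> x * indicator {0..a} x" for x
  have \<phi>0: "\<phi>0 \<in> L2" "\<And>x. x \<notin> {0..a} \<Longrightarrow> \<phi>0 x = 0"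
    unfolding \<phi>0_def[abs_def] by (auto intro: L2_restrict \<phi>L2)
  have \<phi>_eq: "AE x in lebesgue. \<phi> x = \<phi>0 x"
    using AE_ess_supp[of \<phi>] by eventually_elim (auto simp: supp \<phi>0_def indicator_def)
  have \<delta>: "0 < 1 - c\<^sup>2" using c by (simp add: power_less_one_iff abs_square_less_1)
  have "\<exists>C>0. \<forall>b M K \<alpha>. 0 < b \<and> C * b / \<epsilon> \<le> real M \<and> finite K
      \<and> (\<forall>k\<in>K. lo \<le> of_int k / b \<and> (of_int k + a) / b \<le> hi) \<and> (\<Sum>k\<in>K. (cmod (\<alpha> k))\<^sup>2) \<le> b
    \<longrightarrow> (\<exists>t \<in> sampling_space T1 T2 \<epsilon> M.
          (L2_norm (\<lambda>x. (\<Sum>k\<in>K. \<alpha> k * \<phi>0 (b * x - of_int k)) - t x))\<^sup>2 \<le> 1 - c\<^sup>2)"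
    by (intro sampling_space_approximation \<phi>0 a0(1) \<delta>)
  then obtain C where C: "0 < C"
    and approx: "\<forall>b M K \<alpha>. 0 < b \<and> C * b / \<epsilon> \<le> real M \<and> finite K
      \<and> (\<forall>k\<in>K. lo \<le> of_int k / b \<and> (of_int k + a) / b \<le> hi) \<and> (\<Sum>k\<in>K. (cmod (\<alpha> k))\<^sup>2) \<le> b
    \<longrightarrow> (\<exists>t \<in> sampling_space T1 T2 \<epsilon> M.
          (L2_norm (\<lambda>x. (\<Sum>k\<in>K. \<alpha> k * \<phi>0 (b * x - of_int k)) - t x))\<^sup>2 \<le> 1 - c\<^sup>2)"
    by (elim exE conjE) (rule that)
  show thesis
  proof (rule that[OF C])
    fix R N M
    assume N: "1 \<le> N" "N \<le> recon_dim a R" and M: "C * 2 ^ R / \<epsilon> \<le> real M"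
    define b :: real where "b = 2 ^ R"
    have b: "0 < b" by (simp add: b_def)
    have main: "c \<le> L2_norm (L2_proj (sampling_space T1 T2 \<epsilon> M) f)"
      if f: "f \<in> recon_space \<phi> \<psi> a N" "L2_norm f = 1" for f
    proof -
      have fV: "f \<in> V (int R)" and f0: "AE x in lebesgue. x \<notin> {- T1..T2} \<longrightarrow> f x = 0"
        using recon_space_subset[OF mra wav a supp T12 N(2)] f(1) by auto
      have fL2: "f \<in> L2" using fV V0(3) by auto
      \<comment> \<open>Rescaling moves f to V_0, where the integer translates are orthonormal; its
        squared norm becomes b, which is the energy allowed in \<open>approx\<close>.\<close>
      define F where "F x = f (x / b)" for x
      have FV: "F \<in> V 0" using mra_contract[OF mra fV] by (simp add: F_def[abs_def] b_def)
      have F_norm: "(L2_norm F)\<^sup>2 = b"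
        using L2_affine(2)[OF fL2, of "1 / b" 0] b f(2) by (simp add: F_def[abs_def] field_simps)
      have "AE x in lebesgue. 0 + 1 / b * x \<notin> {- T1..T2} \<longrightarrow> f (0 + 1 / b * x) = 0"
        by (rule AE_affine[OF f0]) (use b in simp)
      then have F0: "AE x in lebesgue. x \<notin> {- T1 * b..T2 * b} \<longrightarrow> F x = 0"
      proof eventually_elim
        case (elim x)
        then show ?case using b by (auto simp: F_def field_simps)
      qed
      obtain K \<alpha> where K: "finite K" and F_eq: "AE x in lebesgue. F x = (\<Sum>k\<in>K. \<alpha> k * \<phi> (x - of_int k))"
        and Ksupp: "\<And>k. k \<in> K \<Longrightarrow> - T1 * b \<le> of_int k \<and> of_int k + a \<le> T2 * b"
        and \<alpha>: "(\<Sum>k\<in>K. (cmod (\<alpha> k))\<^sup>2) = (L2_norm F)\<^sup>2"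
        by (rule onb_compact_support_representation[OF V0(2,1) supp(1) a0(2) FV F0]) (rule that)
      have "AE x in lebesgue. \<forall>k\<in>K. \<phi> (b * x - of_int k) = \<phi>0 (b * x - of_int k)"
      proof (subst AE_ball_countable)
        show "countable K" using K by (simp add: countable_finite)
        show "\<forall>k\<in>K. AE x in lebesgue. \<phi> (b * x - of_int k) = \<phi>0 (b * x - of_int k)"
        proof
          fix k
          show "AE x in lebesgue. \<phi> (b * x - of_int k) = \<phi>0 (b * x - of_int k)"
            using AE_affine[OF \<phi>_eq, of b "- of_int k"] b by simp
        qed
      qed
      moreover have "AE x in lebesgue. F (0 + b * x) = (\<Sum>k\<in>K. \<alpha> k * \<phi> (0 + b * x - of_int k))"
        by (rule AE_affine[OF F_eq]) (use b in simp)
      ultimately have f_eq: "AE x in lebesgue. f x = (\<Sum>k\<in>K. \<alpha> k * \<phi>0 (b * x - of_int k))"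
        by eventually_elim (use b in \<open>simp add: F_def\<close>)
      have inside: "lo \<le> of_int k / b \<and> (of_int k + a) / b \<le> hi" if "k \<in> K" for k
      proof -
        have "- T1 \<le> of_int k / b" "(of_int k + a) / b \<le> T2"
          using Ksupp[OF that] b by (auto simp: pos_le_divide_eq pos_divide_le_eq)
        then show ?thesis using lo hi by linarith
      qed
      have "\<exists>t \<in> sampling_space T1 T2 \<epsilon> M.
          (L2_norm (\<lambda>x. (\<Sum>k\<in>K. \<alpha> k * \<phi>0 (b * x - of_int k)) - t x))\<^sup>2 \<le> 1 - c\<^sup>2"
        by (rule approx[rule_format]) (use b M K \<alpha> F_norm inside in \<open>simp add: b_def\<close>)
      then obtain t where t: "t \<in> sampling_space T1 T2 \<epsilon> M"
        and ft: "(L2_norm (\<lambda>x. (\<Sum>k\<in>K. \<alpha> k * \<phi>0 (b * x - of_int k)) - t x))\<^sup>2 \<le> 1 - c\<^sup>2"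
        by blast
      have tL2: "t \<in> L2" using t unfolding sampling_space_def by (rule span_L2) simp
      have sL2: "(\<lambda>x. \<Sum>k\<in>K. \<alpha> k * \<phi>0 (b * x - of_int k)) \<in> L2"
        using a b K by (intro norm_sum_translates(1)[where a = a] \<phi>0) auto
      have "L2_norm (\<lambda>x. f x - t x) = L2_norm (\<lambda>x. (\<Sum>k\<in>K. \<alpha> k * \<phi>0 (b * x - of_int k)) - t x)"
      proof (intro L2_norm_cong_AE L2_diff fL2 tL2 sL2)
        show "AE x in lebesgue. f x - t x = (\<Sum>k\<in>K. \<alpha> k * \<phi>0 (b * x - of_int k)) - t x"
          using f_eq by eventually_elim simp
      qed
      moreover have "(L2_norm f)\<^sup>2 - (L2_norm (\<lambda>x. f x - t x))\<^sup>2
          \<le> (L2_norm (L2_proj (sampling_space T1 T2 \<epsilon> M) f))\<^sup>2"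
        using t unfolding sampling_space_def by (intro norm_projection fL2) auto
      ultimately have "c\<^sup>2 \<le> (L2_norm (L2_proj (sampling_space T1 T2 \<epsilon> M) f))\<^sup>2"
        using ft f(2) by simp
      then show ?thesis by (rule power2_le_imp_le) (rule L2_norm_nonneg)
    qed
    show "c \<le> subspace_cos \<phi> \<psi> a T1 T2 \<epsilon> N M"
      unfolding subspace_cos_def
    proof (rule cInf_greatest)
      obtain f where "f \<in> recon_space \<phi> \<psi> a N" "L2_norm f = 1"
        by (rule recon_space_unit_vector[OF mra a N(1)]) (rule that)
      then show "{L2_norm (L2_proj (sampling_space T1 T2 \<epsilon> M) f) |f.
            f \<in> recon_space \<phi> \<psi> a N \<and> L2_norm f = 1} \<noteq> {}" by blast
    qed (use main in auto)
  qed
qed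

text \<open>Take the least admissible R. If R > 0, minimality gives N > N_(R-1) >= 2^(R-1)
  \<lceil>a\<rceil>; for R = 0 there is no predecessor to compare with, hence the condition.\<close>

lemma recon_dim_cover:
  assumes "1 \<le> a"
  obtains R where "N \<le> recon_dim a R" "0 < R \<Longrightarrow> 2 ^ R * of_int \<lceil>a\<rceil> \<le> 2 * real N"
proof -
  have ca: "1 \<le> \<lceil>a\<rceil>" using assms by linarith
  have "N \<le> recon_dim a N"
  proof -
    have "2 ^ N * 1 \<le> 2 ^ N * nat \<lceil>a\<rceil>" using ca by (intro mult_le_mono) linarith+
    then show ?thesis unfolding recon_dim_def using less_exp[of N] by linarith
  qed
  define R where "R = (LEAST R. N \<le> recon_dim a R)"
  have R: "N \<le> recon_dim a R" unfolding R_def by (rule LeastI) fact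
  have pos: "2 ^ R * of_int \<lceil>a\<rceil> \<le> 2 * real N" if "0 < R"
  proof -
    obtain Q where Q: "R = Suc Q" using \<open>0 < R\<close> by (cases R) auto
    have "\<not> N \<le> recon_dim a Q" using not_less_Least[of Q "\<lambda>R. N \<le> recon_dim a R"] Q R_def by auto
    then have "2 ^ Q * nat \<lceil>a\<rceil> \<le> N" by (simp add: recon_dim_def)
    then have "real (2 ^ Q * nat \<lceil>a\<rceil>) \<le> real N" by (rule of_nat_mono)
    then show ?thesis using Q ca by simp
  qed
  with R show thesis using that by blast
qed

theorem theorem4p1:
  fixes \<phi> \<psi> :: "real \<Rightarrow> complex" and V :: "int \<Rightarrow> (real \<Rightarrow> complex) set"
    and a T1 T2 \<epsilon> :: real
  assumes "mra V \<phi>" and "assoc_wavelet V \<psi>"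
    and "1 \<le> a" and "ess_supp \<phi> = {0..a}" and "ess_supp \<psi> = {0..a}"
    and "T1 \<ge> of_int \<lceil>a\<rceil> - 1" and "T2 \<ge> 2 * of_int \<lceil>a\<rceil> - 1"
    and "0 < \<epsilon>" and "\<epsilon> \<le> 1 / (T1 + T2)"
  shows "\<forall>\<theta>::real. 1 < \<theta> \<longrightarrow>
    (\<exists>S::nat. 1 \<le> S \<and>
      (\<forall>R N. 1 \<le> R \<and> 1 \<le> N \<and> N \<le> recon_dim a R \<longrightarrow>
         subspace_cos \<phi> \<psi> a T1 T2 \<epsilon> N (nat \<lceil>real S * 2 ^ (R + 1) / \<epsilon>\<rceil>) \<ge> 1 / \<theta>) \<and>
      (\<forall>N\<ge>1. stable_sampling_rate \<phi> \<psi> a T1 T2 \<epsilon> N \<theta>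
         \<le> enat (nat \<lceil>2 * real S * real N / (\<epsilon> * of_int \<lceil>a\<rceil>)\<rceil>))) \<and>
    (\<lambda>N. real (the_enat (stable_sampling_rate \<phi> \<psi> a T1 T2 \<epsilon> N \<theta>))) \<in> O(\<lambda>N. real N)"
proof (intro allI impI)
  fix \<theta> :: real assume \<theta>: "1 < \<theta>"
  let ?cos = "subspace_cos \<phi> \<psi> a T1 T2 \<epsilon>"
  let ?rate = "\<lambda>N. stable_sampling_rate \<phi> \<psi> a T1 T2 \<epsilon> N \<theta>"
  define A where "A = real_of_int \<lceil>a\<rceil>"
  have A: "1 \<le> A" unfolding A_def using assms(3) by linarith
  \<comment> \<open>The midpoint of 1/\<theta> and 1: it exceeds 1/\<theta>, as the strict
    inequality in the sampling rate requires, and stays below 1, as the approximation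
    requires.\<close>
  define c where "c = (1 / \<theta> + 1) / 2"
  have c: "1 / \<theta> < c" "c < 1" "0 \<le> c" using \<theta> by (auto simp: c_def field_simps)
  obtain C where C: "0 < C" and cos: "\<And>R N M. \<lbrakk>1 \<le> N; N \<le> recon_dim a R; C * 2 ^ R / \<epsilon> \<le> real M\<rbrakk>
      \<Longrightarrow> c \<le> ?cos N M"
    using subspace_cos_ge[OF assms c(3,2)] by metis
  \<comment> \<open>The factor \<open>A\<close> is needed for the \<open>N\<close> below every \<open>2\<^sup>R\<lceil>a\<rceil>\<close>: the bound on \<open>\<Theta>(N; \<theta>)\<close> then has
    only \<open>S / A\<close> at its disposal.\<close>
  define S where "S = nat \<lceil>C * A\<rceil>"
  have "0 < C * A" using C A by simp
  then have S: "C * A \<le> real S" "1 \<le> S" unfolding S_def by linarith+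
  have "C * 1 \<le> C * A" using C A by (intro mult_left_mono) auto
  then have CS: "C \<le> real S" using S(1) by linarith
  have "1 / \<theta> \<le> ?cos N (nat \<lceil>real S * 2 ^ (R + 1) / \<epsilon>\<rceil>)" if N: "1 \<le> N" "N \<le> recon_dim a R" for R N
  proof -
    have "C * 2 ^ R \<le> real S * 2 ^ (R + 1)" using CS C by (intro mult_mono) auto
    then have "C * 2 ^ R / \<epsilon> \<le> real S * 2 ^ (R + 1) / \<epsilon>" using assms(8) by (intro divide_right_mono) auto
    then have "C * 2 ^ R / \<epsilon> \<le> real (nat \<lceil>real S * 2 ^ (R + 1) / \<epsilon>\<rceil>)" by linarith
    from cos[OF N this] c(1) show ?thesis by linarith
  qed
  moreover have rate: "?rate N \<le> enat (nat \<lceil>2 * real S * real N / (\<epsilon> * of_int \<lceil>a\<rceil>)\<rceil>)" if N: "1 \<le> N" for N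
  proof -
    define M where "M = nat \<lceil>2 * real S * real N / (\<epsilon> * A)\<rceil>"
    obtain R where R: "N \<le> recon_dim a R" "0 < R \<Longrightarrow> 2 ^ R * A \<le> 2 * real N"
      using recon_dim_cover[OF assms(3)] unfolding A_def by metis
    have pos: "0 < 2 * real S * real N / (\<epsilon> * A)" using S N assms(8) A by simp
    have "C * 2 ^ R * A \<le> 2 * real S * real N"
    proof -
      have "C * A * 2 ^ R \<le> real S * (2 * real N)"
      proof (cases "R = 0")
        case True
        have "C * A * 1 \<le> real S * (2 * real N)" using S(1) C A N by (intro mult_mono) auto
        then show ?thesis using True by simp
      next
        case False
        then have "C * (2 ^ R * A) \<le> real S * (2 * real N)"
          using R(2) CS C A by (intro mult_mono[of C "real S" "2 ^ R * A"]) auto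
        then show ?thesis by (simp add: mult_ac)
      qed
      then show ?thesis by (simp add: mult_ac)
    qed
    then have "C * 2 ^ R / \<epsilon> \<le> 2 * real S * real N / (\<epsilon> * A)"
      using assms(8) A by (simp add: field_simps)
    then have "C * 2 ^ R / \<epsilon> \<le> real M" unfolding M_def by linarith
    from cos[OF N R(1) this] have cM: "c \<le> ?cos N M" .
    have "1 \<le> M" unfolding M_def using pos by linarith
    moreover have "1 / ereal (?cos N M) < ereal \<theta>"
    proof -
      have lt: "1 / \<theta> < ?cos N M" using cM c(1) by linarith
      moreover have "0 < 1 / \<theta>" using \<theta> by simp
      ultimately have "0 < ?cos N M" by linarith
      with lt \<theta> have "1 / ?cos N M < \<theta>" by (simp add: field_simps)
      then show ?thesis using \<open>0 < ?cos N M\<close> by (simp add: one_ereal_def)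
    qed
    ultimately have "?rate N \<le> enat M"
      unfolding stable_sampling_rate_def by (intro Inf_lower imageI) auto
    then show ?thesis by (simp add: M_def A_def)
  qed
  moreover have "(\<lambda>N. real (the_enat (?rate N))) \<in> O(\<lambda>N. real N)"
  proof (rule bigoI)
    define B where "B = 2 * real S / (\<epsilon> * A)"
    show "\<forall>\<^sub>F N in at_top. norm (real (the_enat (?rate N))) \<le> (B + 1) * norm (real N)"
      using eventually_ge_at_top[of 1]
    proof eventually_elim
      case (elim N)
      \<comment> \<open>\<open>the_enat\<close> is informative only at finite values, and
        \<open>rate\<close> supplies the finiteness.\<close>
      obtain m where m: "?rate N = enat m" using rate[OF elim] by (cases "?rate N") auto
      with rate[OF elim] have "m \<le> nat \<lceil>2 * real S * real N / (\<epsilon> * A)\<rceil>" by (simp add: A_def)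
      also have "2 * real S * real N / (\<epsilon> * A) = B * real N" by (simp add: B_def)
      finally have "m \<le> nat \<lceil>B * real N\<rceil>" .
      moreover have "0 \<le> B * real N" using A assms(8) by (simp add: B_def)
      \<comment> \<open>The ceiling costs at most 1, which N >= 1 absorbs into the constant B +
        1.\<close>
      ultimately have "real m \<le> B * real N + 1" by linarith
      then show ?case using m elim by (simp add: algebra_simps)
    qed
  qed
  ultimately show "(\<exists>S::nat. 1 \<le> S \<and>
      (\<forall>R N. 1 \<le> R \<and> 1 \<le> N \<and> N \<le> recon_dim a R \<longrightarrow>
         ?cos N (nat \<lceil>real S * 2 ^ (R + 1) / \<epsilon>\<rceil>) \<ge> 1 / \<theta>) \<and>
      (\<forall>N\<ge>1. ?rate N \<le> enat (nat \<lceil>2 * real S * real N / (\<epsilon> * of_int \<lceil>a\<rceil>)\<rceil>))) \<and>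
    (\<lambda>N. real (the_enat (?rate N))) \<in> O(\<lambda>N. real N)"
    using S(2) by blast
qed

end
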